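(* Let $n\ge3$. A Gröbner basis (with respect to the monomial order described in the context) for the $S$-submodule $\mathrm{im}(\Psi)\subset F$ is given by $\mathcal G=\bigcup_{1\le k<j<i\le n}\mathcal G_{ijk}$, where $\mathcal G_{ijk}=\mathcal B_{ijk}\cup\mathcal D_{ijk}$ and $$\mathcal D_{ijk}=\{x_{kl}x_{kp}\cdot r_{ijk},\ \ x_{jq}x_{kp}\cdot r_{ijk}\ \mid\ 1\le p\le l<k,\ 1\le q\le k\}.$$
   Context: $S=\mathbb C[x_{ij}\mid1\le j<i\le n]$ and $F$ is the free $S$-module with basis $\{r_{ijk}\mid1\le k<j<i\le n\}$. For each $1\le k<j<i\le n$, $\mathcal B_{ijk}$ is the set of the following elements of $F$, for all indices with $1\le l_1<k<l_2<j<l_3<i<l_4\le n$ and all $1\le t<s\le n$ with $\{s,t\}\cap\{i,j,k\}=\emptyset$ (each element being included for every admissible value of the indices it involves): - $(-x_{jk}-x_{l_2k})r_{ijl_2}+x_{jl_2}r_{ijk}$; - $x_{jk}r_{ijl_2}+x_{il_2}r_{ijk}$; - $-x_{jk}r_{il_3j}+x_{il_3}r_{ijk}$; - $x_{jk}r_{l_4ij}+x_{l_4i}r_{ijk}$; - $(x_{il_1}+x_{jl_1}+x_{kl_1})r_{ijk}$; $(x_{ik}+x_{jk})r_{ijk}$; - $x_{l_2k}r_{ijk}$; $x_{l_3k}r_{ijk}$; $x_{l_3j}r_{ijk}$; $x_{l_4k}r_{ijk}$; $x_{l_4j}r_{ijk}$; $x_{st}r_{ijk}$. $\mathrm{im}(\Psi)$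 is the submodule of $F$ generated by $\bigcup_{k<j<i}\mathcal B_{ijk}$ (so that $F/\mathrm{im}(\Psi)$ is the infinitesimal Alexander invariant of the upper McCool group $P\Sigma_n^+$). Monomial order: order the variables by $x_{st}\succ x_{kl}$ if $s>k$, or $s=k$ and $t>l$. Monomials of $S$ carry the corresponding graded reverse lexicographic order: with exponents listed in decreasing order of the variables, $\mathbf x^\alpha\succ\mathbf x^\beta$ if $\deg\mathbf x^\alpha>\deg\mathbf x^\beta$, or degrees are equal and the right-most nonzero entry of $\alpha-\beta$ is negative. Order the basis of $F$ by $r_{lst}\succ r_{ijk}$ if $i>l$, or $i=l$ and $j>s$, or $i=l$, $j=s$ and $k>t$. On $F$: $\mathbf x^\alpha r_{lst}\succ\mathbf x^\beta r_{ijk}$ if $r_{lst}\succ r_{ijk}$, or $r_{lst}=r_{ijk}$ and $\mathbf x^\alpha\succ\mathbf x^\beta$. A finite subset of a submodule $I\subset F$ is a Gröbner basis if it generates $I$ and its initial (largest) terms generate the submodule $\mathrm{in}_\succ(I)$ generated by initial terms of all elements of $I$. *)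

theory Defs
  imports Complex_Main "HOL-Library.Poly_Mapping" "HOL-Algebra.Module"
begin

text \<open>Power products in variables indexed by pairs of naturals, complex polynomials in these
  variables, and vectors with polynomial entries indexed by triples. The ring \<open>S\<close> and the module
  \<open>F\<close> for a given \<open>n\<close> are carved out as carriers below.\<close>

type_synonym power_prod = "nat \<times> nat \<Rightarrow>\<^sub>0 nat"
type_synonym cpoly = "power_prod \<Rightarrow>\<^sub>0 complex"
type_synonym cvec = "nat \<times> nat \<times> nat \<Rightarrow>\<^sub>0 cpoly"

definition var_indices :: "nat \<Rightarrow> (nat \<times> nat) set" where
  "var_indices n = {(i, j). 1 \<le> j \<and> j < i \<and> i \<le> n}"

definition basis_indices :: "nat \<Rightarrow> (nat \<times> nat \<times> nat) set" where
  "basis_indices n = {(i, j, k). 1 \<le> k \<and> k < j \<and> j < i \<and> i \<le> n}"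

definition S_ring :: "nat \<Rightarrow> cpoly ring" where
  "S_ring n = \<lparr>carrier = {p. \<forall>\<alpha>\<in>Poly_Mapping.keys p. Poly_Mapping.keys \<alpha> \<subseteq> var_indices n},
     mult = (*), one = 1, zero = 0, add = (+)\<rparr>"

definition scale_vec :: "cpoly \<Rightarrow> cvec \<Rightarrow> cvec"  (infixr \<open>\<odot>\<^sub>F\<close> 75) where
  "p \<odot>\<^sub>F f = Poly_Mapping.map ((*) p) f"

text \<open>Module records extend ring records, so they have fields \<open>mult\<close> and \<open>one\<close>, which play
  no role for modules.\<close>

definition F_module :: "nat \<Rightarrow> (cpoly, cvec) module" where
  "F_module n = \<lparr>carrier = {f. Poly_Mapping.keys f \<subseteq> basis_indices n \<and>
       (\<forall>b. Poly_Mapping.lookup f b \<in> carrier (S_ring n))},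
     mult = undefined, one = undefined, zero = 0, add = (+), smult = (\<odot>\<^sub>F)\<rparr>"

lemma lookup_scale_vec [simp]:
  "Poly_Mapping.lookup (p \<odot>\<^sub>F f) b = p * Poly_Mapping.lookup f b"
  by (simp add: scale_vec_def Poly_Mapping.map.rep_eq when_def)

lemma keys_subset_iff:
  "Poly_Mapping.keys a \<subseteq> V \<longleftrightarrow> (\<forall>v. v \<notin> V \<longrightarrow> Poly_Mapping.lookup a v = 0)"
  by (auto simp: in_keys_iff)

lemma S_ring_closed:
  "0 \<in> carrier (S_ring n)" "1 \<in> carrier (S_ring n)"
  "p \<in> carrier (S_ring n) \<Longrightarrow> - p \<in> carrier (S_ring n)"
  "p \<in> carrier (S_ring n) \<Longrightarrow> q \<in> carrier (S_ring n) \<Longrightarrow> p + q \<in> carrier (S_ring n)"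
  "p \<in> carrier (S_ring n) \<Longrightarrow> q \<in> carrier (S_ring n) \<Longrightarrow> p * q \<in> carrier (S_ring n)"
proof -
  assume "p \<in> carrier (S_ring n)" "q \<in> carrier (S_ring n)"
  then show "p + q \<in> carrier (S_ring n)"
    using Poly_Mapping.keys_add[of p q] by (auto simp: S_ring_def)
next
  assume pq: "p \<in> carrier (S_ring n)" "q \<in> carrier (S_ring n)"
  show "p * q \<in> carrier (S_ring n)"
    unfolding S_ring_def
  proof (simp, intro ballI)
    fix a assume "a \<in> Poly_Mapping.keys (p * q)"
    then obtain c d where cd: "a = c + d" "c \<in> Poly_Mapping.keys p" "d \<in> Poly_Mapping.keys q"
      using keys_mult[of p q] by blast
    with pq have "Poly_Mapping.keys c \<union> Poly_Mapping.keys d \<subseteq> var_indices n"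
      by (simp add: S_ring_def)
    then show "Poly_Mapping.keys a \<subseteq> var_indices n"
      using Poly_Mapping.keys_add[of c d] cd(1) by blast
  qed
qed (auto simp: S_ring_def)

lemma S_ring_ops [simp]:
  "add (S_ring n) = (+)" "mult (S_ring n) = (*)" "zero (S_ring n) = 0" "one (S_ring n) = 1"
  by (simp_all add: S_ring_def)

lemma F_module_ops [simp]:
  "add (F_module n) = (+)" "zero (F_module n) = 0" "smult (F_module n) = (\<odot>\<^sub>F)"
  by (simp_all add: F_module_def)

lemma cring_S_ring: "cring (S_ring n)"
proof (rule cringI)
  show "abelian_group (S_ring n)"
  proof (rule abelian_groupI)
    fix p assume "p \<in> carrier (S_ring n)"
    then show "\<exists>q\<in>carrier (S_ring n). q \<oplus>\<^bsub>S_ring n\<^esub> p = \<zero>\<^bsub>S_ring n\<^esub>"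
      by (intro bexI[of _ "- p"]) (simp_all add: S_ring_closed)
  qed (simp_all add: S_ring_closed add_ac)
  show "comm_monoid (S_ring n)"
    by (rule comm_monoidI) (simp_all add: S_ring_closed mult_ac)
qed (simp add: distrib_right)

lemma F_module_closed:
  "0 \<in> carrier (F_module n)"
  "f \<in> carrier (F_module n) \<Longrightarrow> - f \<in> carrier (F_module n)"
  "f \<in> carrier (F_module n) \<Longrightarrow> g \<in> carrier (F_module n) \<Longrightarrow> f + g \<in> carrier (F_module n)"
  "p \<in> carrier (S_ring n) \<Longrightarrow> f \<in> carrier (F_module n) \<Longrightarrow> p \<odot>\<^sub>F f \<in> carrier (F_module n)"
  by (simp_all add: F_module_def keys_subset_iff lookup_add S_ring_closed)

lemma module_F_module: "module (S_ring n) (F_module n)"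
proof (rule moduleI)
  show "abelian_group (F_module n)"
  proof (rule abelian_groupI)
    fix f assume "f \<in> carrier (F_module n)"
    then show "\<exists>g\<in>carrier (F_module n). g \<oplus>\<^bsub>F_module n\<^esub> f = \<zero>\<^bsub>F_module n\<^esub>"
      by (intro bexI[of _ "- f"]) (simp_all add: F_module_closed)
  qed (simp_all add: F_module_closed add_ac)
qed (simp_all add: cring_S_ring F_module_closed poly_mapping_eq_iff fun_eq_iff lookup_add
    distrib_left distrib_right mult.assoc)

definition generated_submodule :: "nat \<Rightarrow> cvec set \<Rightarrow> cvec set" where
  "generated_submodule n A = (\<lambda>N. submodule N (S_ring n) (F_module n)) hull A"

lemma submodule_generated_submodule:
  assumes "A \<subseteq> carrier (F_module n)"
  shows "submodule (generated_submodule n A) (S_ring n) (F_module n)"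
proof -
  interpret M: module "S_ring n" "F_module n" by (rule module_F_module)
  let ?Q = "{N. submodule N (S_ring n) (F_module n) \<and> A \<subseteq> N}"
  have top: "carrier (F_module n) \<in> ?Q"
    using assms M.carrier_is_submodule by simp
  have sub: "subgroup N (add_monoid (F_module n))" if "N \<in> ?Q" for N
    using that by (simp add: submodule_def)
  show ?thesis
    unfolding generated_submodule_def hull_def
  proof (rule M.submoduleI)
    show "\<Inter>?Q \<subseteq> carrier (F_module n)"
      using top by blast
    show "\<zero>\<^bsub>F_module n\<^esub> \<in> \<Inter>?Q"
      using sub subgroup.one_closed by fastforce
  next
    fix a assume "a \<in> \<Inter>?Q"
    then show "\<ominus>\<^bsub>F_module n\<^esub> a \<in> \<Inter>?Q"
      using M.submoduleE(3) by blast
  next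
    fix a b assume "a \<in> \<Inter>?Q" "b \<in> \<Inter>?Q"
    then show "a \<oplus>\<^bsub>F_module n\<^esub> b \<in> \<Inter>?Q"
      using M.submoduleE(5) by blast
  next
    fix a b assume "a \<in> carrier (S_ring n)" "b \<in> \<Inter>?Q"
    then show "a \<odot>\<^bsub>F_module n\<^esub> b \<in> \<Inter>?Q"
      using M.submoduleE(4) by blast
  qed
qed

definition xv :: "nat \<Rightarrow> nat \<Rightarrow> cpoly" where
  "xv i j = Poly_Mapping.single (Poly_Mapping.single (i, j) 1) 1"

definition rb :: "nat \<Rightarrow> nat \<Rightarrow> nat \<Rightarrow> cvec" where
  "rb i j k = Poly_Mapping.single (i, j, k) 1"


lemma xv_closed: "1 \<le> j \<Longrightarrow> j < i \<Longrightarrow> i \<le> n \<Longrightarrow> xv i j \<in> carrier (S_ring n)"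
  by (auto simp: xv_def S_ring_def var_indices_def)

lemma rb_closed:
  "1 \<le> k \<Longrightarrow> k < j \<Longrightarrow> j < i \<Longrightarrow> i \<le> n \<Longrightarrow> rb i j k \<in> carrier (F_module n)"
  using S_ring_closed(1,2)[of n]
  by (auto simp: rb_def F_module_def basis_indices_def lookup_single when_def)


section \<open>The submodule and its proposed Groebner basis\<close>

definition B_set :: "nat \<Rightarrow> nat \<Rightarrow> nat \<Rightarrow> nat \<Rightarrow> cvec set" where
  "B_set n i j k =
     {(- xv j k - xv l2 k) \<odot>\<^sub>F rb i j l2 + xv j l2 \<odot>\<^sub>F rb i j k | l2. k < l2 \<and> l2 < j} \<union>
     {xv j k \<odot>\<^sub>F rb i j l2 + xv i l2 \<odot>\<^sub>F rb i j k | l2. k < l2 \<and> l2 < j} \<union>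
     {- xv j k \<odot>\<^sub>F rb i l3 j + xv i l3 \<odot>\<^sub>F rb i j k | l3. j < l3 \<and> l3 < i} \<union>
     {xv j k \<odot>\<^sub>F rb l4 i j + xv l4 i \<odot>\<^sub>F rb i j k | l4. i < l4 \<and> l4 \<le> n} \<union>
     {(xv i l1 + xv j l1 + xv k l1) \<odot>\<^sub>F rb i j k | l1. 1 \<le> l1 \<and> l1 < k} \<union>
     {(xv i k + xv j k) \<odot>\<^sub>F rb i j k} \<union>
     {xv l2 k \<odot>\<^sub>F rb i j k | l2. k < l2 \<and> l2 < j} \<union>
     {xv l3 k \<odot>\<^sub>F rb i j k | l3. j < l3 \<and> l3 < i} \<union>
     {xv l3 j \<odot>\<^sub>F rb i j k | l3. j < l3 \<and> l3 < i} \<union>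
     {xv l4 k \<odot>\<^sub>F rb i j k | l4. i < l4 \<and> l4 \<le> n} \<union>
     {xv l4 j \<odot>\<^sub>F rb i j k | l4. i < l4 \<and> l4 \<le> n} \<union>
     {xv s t \<odot>\<^sub>F rb i j k | s t. 1 \<le> t \<and> t < s \<and> s \<le> n \<and> {s, t} \<inter> {i, j, k} = {}}"

definition D_set :: "nat \<Rightarrow> nat \<Rightarrow> nat \<Rightarrow> cvec set" where
  "D_set i j k =
     {(xv k l * xv k p) \<odot>\<^sub>F rb i j k | l p. 1 \<le> p \<and> p \<le> l \<and> l < k} \<union>
     {(xv j q * xv k p) \<odot>\<^sub>F rb i j k | l p q. 1 \<le> p \<and> p \<le> l \<and> l < k \<and> 1 \<le> q \<and> q \<le> k}"

definition G_set :: "nat \<Rightarrow> nat \<Rightarrow> nat \<Rightarrow> nat \<Rightarrow> cvec set" where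
  "G_set n i j k = B_set n i j k \<union> D_set i j k"

lemma S_ring_diff_closed:
  "p \<in> carrier (S_ring n) \<Longrightarrow> q \<in> carrier (S_ring n) \<Longrightarrow> p - q \<in> carrier (S_ring n)"
  using S_ring_closed(3)[of q n] S_ring_closed(4)[of p n "- q"] by simp

lemma G_set_closed:
  assumes "(i, j, k) \<in> basis_indices n"
  shows "G_set n i j k \<subseteq> carrier (F_module n)"
proof -
  have ijk: "1 \<le> k" "k < j" "j < i" "i \<le> n"
    using assms by (auto simp: basis_indices_def)
  show ?thesis
    unfolding G_set_def B_set_def D_set_def Un_subset_iff
    using ijk
    by (intro conjI; clarsimp;
      intro F_module_closed S_ring_closed S_ring_diff_closed xv_closed rb_closed; linarith)
qed

definition im_Psi :: "nat \<Rightarrow> cvec set" where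
  "im_Psi n = generated_submodule n (\<Union>(i, j, k)\<in>basis_indices n. B_set n i j k)"


section \<open>Monomial order and Groebner bases\<close>

definition var_greater :: "nat \<times> nat \<Rightarrow> nat \<times> nat \<Rightarrow> bool" where
  "var_greater = (\<lambda>(s, t) (k, l). s > k \<or> (s = k \<and> t > l))"

definition total_deg :: "power_prod \<Rightarrow> nat" where
  "total_deg \<alpha> = (\<Sum>v\<in>Poly_Mapping.keys \<alpha>. Poly_Mapping.lookup \<alpha> v)"

text \<open>With exponents listed in decreasing order of the variables, the right-most nonzero entry of
  \<open>\<alpha> - \<beta>\<close> is at the smallest variable \<open>v\<close> where \<open>\<alpha>\<close> and \<open>\<beta>\<close> differ. Index pairs outside
  \<open>var_indices n\<close> have exponent 0 in all power products of \<open>S\<close>, so they never matter.\<close>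

definition power_prod_greater :: "power_prod \<Rightarrow> power_prod \<Rightarrow> bool" where
  "power_prod_greater \<alpha> \<beta> \<longleftrightarrow>
     total_deg \<alpha> > total_deg \<beta> \<or>
     (total_deg \<alpha> = total_deg \<beta> \<and>
      (\<exists>v. Poly_Mapping.lookup \<alpha> v < Poly_Mapping.lookup \<beta> v \<and>
           (\<forall>w. var_greater v w \<longrightarrow> Poly_Mapping.lookup \<alpha> w = Poly_Mapping.lookup \<beta> w)))"

text \<open>Smaller indices give larger basis elements.\<close>

definition basis_greater :: "nat \<times> nat \<times> nat \<Rightarrow> nat \<times> nat \<times> nat \<Rightarrow> bool" where
  "basis_greater = (\<lambda>(l, s, t) (i, j, k). i > l \<or> (i = l \<and> j > s) \<or> (i = l \<and> j = s \<and> k > t))"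

definition term_greater ::
    "power_prod \<times> nat \<times> nat \<times> nat \<Rightarrow> power_prod \<times> nat \<times> nat \<times> nat \<Rightarrow> bool" where
  "term_greater = (\<lambda>(\<alpha>, b) (\<beta>, c). basis_greater b c \<or> (b = c \<and> power_prod_greater \<alpha> \<beta>))"

definition vec_terms :: "cvec \<Rightarrow> (power_prod \<times> nat \<times> nat \<times> nat) set" where
  "vec_terms f = {(\<alpha>, b). \<alpha> \<in> Poly_Mapping.keys (Poly_Mapping.lookup f b)}"

text \<open>Initial terms include their coefficient; the initial term of 0 is 0.\<close>

definition initial_term :: "cvec \<Rightarrow> cvec" where
  "initial_term f = (if f = 0 then 0 else
     (let (\<alpha>, b) = (THE u. u \<in> vec_terms f \<and> (\<forall>w\<in>vec_terms f. w \<noteq> u \<longrightarrow> term_greater u w))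
      in Poly_Mapping.single b
           (Poly_Mapping.single \<alpha> (Poly_Mapping.lookup (Poly_Mapping.lookup f b) \<alpha>))))"

definition initial_submodule :: "nat \<Rightarrow> cvec set \<Rightarrow> cvec set" where
  "initial_submodule n I = generated_submodule n (initial_term ` I)"

definition groebner_basis :: "nat \<Rightarrow> cvec set \<Rightarrow> cvec set \<Rightarrow> bool" where
  "groebner_basis n I G \<longleftrightarrow>
     submodule I (S_ring n) (F_module n) \<and> finite G \<and> G \<subseteq> I \<and>
     generated_submodule n G = I \<and>
     generated_submodule n (initial_term ` G) = initial_submodule n I"

end

theory Submission
  imports Defs
begin

text \<open>
  No S-pairs are reduced. Call a term standard if no initial term of the proposed basis divides it:
  on \<open>r\<^bsub>ijk\<^esub>\<close> these are the monomials in \<open>x\<^bsub>ij\<^esub>\<close> and the \<open>x\<^bsub>jq\<^esub>\<close> with \<open>q \<le> k\<close>, and the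
  monomials \<open>x\<^bsub>ij\<^esub>\<^sup>a x\<^bsub>kp\<^esub>\<close> with \<open>p < k\<close>. For each standard term there is an explicit
  functional that vanishes on \<open>im \<Psi>\<close> but not on any vector led by that term, so no
  standard term is initial in \<open>im \<Psi>\<close>.

  Monomials of the first kind are detected, for fixed \<open>i > j\<close>, by the module homomorphism
  \<open>r\<^bsub>ijk\<^esub> \<mapsto> x\<^bsub>jk\<^esub>\<close> to the polynomials in \<open>x\<^bsub>ij\<^esub>\<close> and \<open>x\<^bsub>jq\<^esub>\<close>, on which \<open>x\<^bsub>iq\<^esub>\<close> acts as
  \<open>- x\<^bsub>jq\<^esub>\<close> and the remaining variables act as \<open>0\<close>. Those of the second kind are
  detected by a signed sum of five coefficients on the basis elements indexed by the triples in
  \<open>{i, j, k, p}\<close>.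
\<close>

section \<open>Substitutions that send variables to scalar multiples of variables\<close>

lemma poly_mapping_expand:
  "p = (\<Sum>\<alpha>\<in>Poly_Mapping.keys p. Poly_Mapping.single \<alpha> (Poly_Mapping.lookup p \<alpha>))"
  by (rule poly_mapping_eqI) (simp add: lookup_sum lookup_single when_def in_keys_iff sum.delta')

text \<open>Every finitely supported map is a finite sum of singles. Polynomials and exponent
  vectors both have this form, so the rule serves for identities about either; cancellation in the
  codomain gives \<open>f 0 = 0\<close> and \<open>g 0 = 0\<close>.\<close>

lemma additive_poly_mapping_eqI:
  fixes f g :: "('a \<Rightarrow>\<^sub>0 'b::comm_monoid_add) \<Rightarrow> 'c::cancel_comm_monoid_add"
  assumes f: "\<And>p q. f (p + q) = f p + f q"
    and g: "\<And>p q. g (p + q) = g p + g q"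
    and single: "\<And>\<alpha> c. f (Poly_Mapping.single \<alpha> c) = g (Poly_Mapping.single \<alpha> c)"
  shows "f p = g p"
proof -
  have f0: "f 0 = 0" and g0: "g 0 = 0"
    using f[of 0 0] g[of 0 0] by simp_all
  have "f (sum h A) = (\<Sum>a\<in>A. f (h a))" "g (sum h A) = (\<Sum>a\<in>A. g (h a))"
    for h :: "'a \<Rightarrow> 'a \<Rightarrow>\<^sub>0 'b" and A
    by (induction A rule: infinite_finite_induct) (simp_all add: f g f0 g0)
  then show ?thesis
    by (subst (1 2) poly_mapping_expand) (simp add: single)
qed

definition rename :: "(nat \<times> nat \<Rightarrow> nat \<times> nat) \<Rightarrow> power_prod \<Rightarrow> power_prod" where
  "rename \<rho> \<alpha> = (\<Sum>v\<in>Poly_Mapping.keys \<alpha>. Poly_Mapping.single (\<rho> v) (Poly_Mapping.lookup \<alpha> v))"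

definition weight :: "(nat \<times> nat \<Rightarrow> complex) \<Rightarrow> power_prod \<Rightarrow> complex" where
  "weight c \<alpha> = (\<Prod>v\<in>Poly_Mapping.keys \<alpha>. c v ^ Poly_Mapping.lookup \<alpha> v)"

text \<open>The algebra endomorphism that maps x_v to \<open>c v\<close> times x_(\<rho> v), so that
  \<open>c v = 0\<close> kills x_v. It sends terms to terms; a coefficient of the image is found by
  asking which monomials \<open>rename\<close> takes to the given one.\<close>

definition subst_scaled ::
    "(nat \<times> nat \<Rightarrow> nat \<times> nat) \<Rightarrow> (nat \<times> nat \<Rightarrow> complex) \<Rightarrow> cpoly \<Rightarrow> cpoly" where
  "subst_scaled \<rho> c p = (\<Sum>\<alpha>\<in>Poly_Mapping.keys p.
     Poly_Mapping.single (rename \<rho> \<alpha>) (weight c \<alpha> * Poly_Mapping.lookup p \<alpha>))"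

lemma rename_add: "rename \<rho> (\<alpha> + \<beta>) = rename \<rho> \<alpha> + rename \<rho> \<beta>"
  unfolding rename_def by (rule setsum_keys_plus_distrib) (simp_all add: single_add)

lemma rename_single [simp]: "rename \<rho> (Poly_Mapping.single v m) = Poly_Mapping.single (\<rho> v) m"
  by (simp add: rename_def)

lemma weight_add: "weight c (\<alpha> + \<beta>) = weight c \<alpha> * weight c \<beta>"
proof -
  let ?A = "Poly_Mapping.keys \<alpha> \<union> Poly_Mapping.keys \<beta>"
  \<comment> \<open>A zeroth power is 1 even where \<open>c v = 0\<close>, so all three products can
    run over the union of the supports.\<close>
  have *: "weight c \<gamma> = (\<Prod>v\<in>?A. c v ^ Poly_Mapping.lookup \<gamma> v)"
    if "Poly_Mapping.keys \<gamma> \<subseteq> ?A" for \<gamma>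
    unfolding weight_def using that
    by (intro prod.mono_neutral_left) (auto simp: in_keys_iff)
  show ?thesis
    using keys_add[of \<alpha> \<beta>]
    by (simp add: * lookup_add power_add prod.distrib)
qed

lemma weight_single [simp]: "weight c (Poly_Mapping.single v m) = c v ^ m"
  by (simp add: weight_def)

lemma weight_nonzeroD: "weight c \<alpha> \<noteq> 0 \<Longrightarrow> Poly_Mapping.lookup \<alpha> v \<noteq> 0 \<Longrightarrow> c v \<noteq> 0"
  by (auto simp: weight_def in_keys_iff)

lemma subst_scaled_add: "subst_scaled \<rho> c (p + q) = subst_scaled \<rho> c p + subst_scaled \<rho> c q"
  unfolding subst_scaled_def
  by (rule setsum_keys_plus_distrib) (simp_all add: single_add distrib_left)

lemma subst_scaled_single [simp]:
  "subst_scaled \<rho> c (Poly_Mapping.single \<alpha> d) = Poly_Mapping.single (rename \<rho> \<alpha>) (weight c \<alpha> * d)"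
  by (simp add: subst_scaled_def)

text \<open>Both sides are additive in each argument, so the identity reduces to single terms, where
  \<open>rename_add\<close> and \<open>weight_add\<close> give it.\<close>

lemma subst_scaled_mult: "subst_scaled \<rho> c (p * q) = subst_scaled \<rho> c p * subst_scaled \<rho> c q"
proof (rule additive_poly_mapping_eqI[where p = p])
  fix \<alpha> d
  show "subst_scaled \<rho> c (Poly_Mapping.single \<alpha> d * q) =
      subst_scaled \<rho> c (Poly_Mapping.single \<alpha> d) * subst_scaled \<rho> c q"
    by (rule additive_poly_mapping_eqI[where p = q])
      (simp_all add: distrib_left distrib_right subst_scaled_add mult_single rename_add weight_add
        mult_ac)
qed (simp_all add: distrib_right subst_scaled_add)

lemma subst_scaled_zero [simp]: "subst_scaled \<rho> c 0 = 0"
  by (simp add: subst_scaled_def)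

lemma subst_scaled_minus: "subst_scaled \<rho> c (- p) = - subst_scaled \<rho> c p"
  using subst_scaled_add[of \<rho> c p "- p"] by (simp add: eq_neg_iff_add_eq_0 add.commute)

section \<open>Functionals vanishing on the submodule\<close>

lemma scale_vec_simps:
  "p \<odot>\<^sub>F (f + g) = p \<odot>\<^sub>F f + p \<odot>\<^sub>F g"
  "(p + q) \<odot>\<^sub>F f = p \<odot>\<^sub>F f + q \<odot>\<^sub>F f"
  "p \<odot>\<^sub>F q \<odot>\<^sub>F f = (p * q) \<odot>\<^sub>F f"
  "p \<odot>\<^sub>F 0 = 0"
  "p \<odot>\<^sub>F (- f) = - (p \<odot>\<^sub>F f)"
  "(- p) \<odot>\<^sub>F f = - (p \<odot>\<^sub>F f)"
  "p \<odot>\<^sub>F (f - g) = p \<odot>\<^sub>F f - p \<odot>\<^sub>F g"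
  "(p - q) \<odot>\<^sub>F f = p \<odot>\<^sub>F f - q \<odot>\<^sub>F f"
  by (rule poly_mapping_eqI, simp add: lookup_add lookup_minus distrib_left distrib_right
    left_diff_distrib right_diff_distrib mult.assoc)+

text \<open>\<open>L\<close> is merely additive, since a coefficient functional is not
  \<open>S\<close>-linear. The kernel of \<open>L\<close> is therefore replaced by the vectors all
  of whose multiples lie in it; these form a submodule that contains the generators.\<close>

lemma functional_vanishes:
  fixes L :: "cvec \<Rightarrow> 'a::ab_group_add"
  assumes A: "A \<subseteq> carrier (F_module n)"
    and add: "\<And>f g. L (f + g) = L f + L g"
    and gen: "\<And>p f. f \<in> A \<Longrightarrow> L (p \<odot>\<^sub>F f) = 0"
    and f: "f \<in> generated_submodule n A"
  shows "L f = 0"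
proof -
  interpret M: module "S_ring n" "F_module n" by (rule module_F_module)
  have zero: "L 0 = 0"
    using add[of 0 0] by simp
  have minus: "L (- g) = - L g" for g
    using add[of g "- g"] zero by (simp add: eq_neg_iff_add_eq_0 add.commute)
  let ?K = "{f \<in> carrier (F_module n). \<forall>p. L (p \<odot>\<^sub>F f) = 0}"
  have inv: "\<ominus>\<^bsub>F_module n\<^esub> g = - g" if "g \<in> carrier (F_module n)" for g
    using that by (intro M.minus_equality) (simp_all add: F_module_closed)
  have "submodule ?K (S_ring n) (F_module n)"
    by (rule M.submoduleI) (auto simp: scale_vec_simps zero add inv minus F_module_closed)
  then have "generated_submodule n A \<subseteq> ?K"
    unfolding generated_submodule_def using A gen by (intro hull_minimal) auto
  then have "\<forall>p. L (p \<odot>\<^sub>F f) = 0"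
    using f by blast
  moreover have "1 \<odot>\<^sub>F f = f"
    by (rule poly_mapping_eqI) simp
  ultimately show ?thesis
    by metis
qed

lemma lookup_rb: "Poly_Mapping.lookup (rb i j k) b = (if b = (i, j, k) then 1 else 0)"
  by (auto simp: rb_def lookup_single when_def)

section \<open>The row homomorphism\<close>

abbreviation row_index :: "nat \<Rightarrow> nat \<Rightarrow> nat \<times> nat \<Rightarrow> nat \<times> nat" where
  "row_index i j \<equiv> (\<lambda>(s, t). if s = i \<and> t < j then (j, t) else (s, t))"

abbreviation row_sign :: "nat \<Rightarrow> nat \<Rightarrow> nat \<times> nat \<Rightarrow> complex" where
  "row_sign i j \<equiv> (\<lambda>(s, t). if s = i \<and> t < j then - 1
     else if s = j \<and> t < j \<or> s = i \<and> t = j then 1 else 0)"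

definition row_subst :: "nat \<Rightarrow> nat \<Rightarrow> cpoly \<Rightarrow> cpoly" where
  "row_subst i j = subst_scaled (row_index i j) (row_sign i j)"

lemma row_subst_xv:
  "row_subst i j (xv s t) =
     (if s = i \<and> t < j then - xv j t
      else if s = j \<and> t < j \<or> s = i \<and> t = j then xv s t else 0)"
  by (simp add: row_subst_def xv_def single_uminus)

lemma row_subst_simps:
  "row_subst i j (p + q) = row_subst i j p + row_subst i j q"
  "row_subst i j (p * q) = row_subst i j p * row_subst i j q"
  "row_subst i j (- p) = - row_subst i j p"
  "row_subst i j (p - q) = row_subst i j p - row_subst i j q"
  "row_subst i j 0 = 0"
  using subst_scaled_add[of _ _ p "- q"]
  by (simp_all add: row_subst_def subst_scaled_add subst_scaled_mult subst_scaled_minus)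

text \<open>Linear over \<open>S\<close> when \<open>S\<close> acts on the codomain through
  \<open>row_subst\<close>. Up to the variable x_lk, which the substitution kills, the first
  relations say x_jl r_ijk = x_jk r_ijl; this suggests the image x_jk for r_ijk.\<close>

definition row_map :: "nat \<Rightarrow> nat \<Rightarrow> cvec \<Rightarrow> cpoly" where
  "row_map i j f = (\<Sum>k<j. xv j k * row_subst i j (Poly_Mapping.lookup f (i, j, k)))"

lemma row_map_add: "row_map i j (f + g) = row_map i j f + row_map i j g"
  by (simp add: row_map_def lookup_add row_subst_def subst_scaled_add distrib_left sum.distrib)

lemma row_map_rb:
  "row_map i j (q \<odot>\<^sub>F rb i' j' k) =
     (if i' = i \<and> j' = j \<and> k < j then xv j k * row_subst i j q else 0)"
proof (cases "i' = i \<and> j' = j")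
  case True
  then have "row_map i j (q \<odot>\<^sub>F rb i' j' k) =
      (\<Sum>l<j. if l = k then xv j k * row_subst i j q else 0)"
    unfolding row_map_def
    by (intro sum.cong) (auto simp: lookup_rb row_subst_def)
  with True show ?thesis
    by (simp add: sum.delta)
qed (auto simp: row_map_def lookup_rb row_subst_def)

lemma row_map_minus: "row_map i j (- f) = - row_map i j f" "row_map i j (f - g) = row_map i j f - row_map i j g"
  by (simp_all add: row_map_def lookup_minus row_subst_simps sum_negf sum_subtractf right_diff_distrib)

text \<open>Two terms on r_ijk and r_ijl cancel because x_jk x_jl is symmetric in k and l. In the
  sums x_il + x_jl + x_kl and x_ik + x_jk the first two summands have opposite images. Every
  remaining coefficient is killed.\<close>

lemma row_map_B_set:
  assumes "(i', j', k') \<in> basis_indices n" and "b \<in> B_set n i' j' k'" and "j < i"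
  shows "row_map i j (p \<odot>\<^sub>F b) = 0"
proof -
  have "b \<in> B_set n i' j' k' \<Longrightarrow> k' < j' \<Longrightarrow> j' < i' \<Longrightarrow> j < i \<Longrightarrow> ?thesis"
    unfolding B_set_def
    by (elim UnE CollectE exE conjE singletonE; hypsubst;
      simp add: scale_vec_simps distrib_left right_diff_distrib row_map_add row_map_minus row_map_rb
        row_subst_simps row_subst_xv)
  then show ?thesis
    using assms by (auto simp: basis_indices_def)
qed

section \<open>The torsion functional\<close>

lemma lookup_mult_xv:
  "Poly_Mapping.lookup (q * xv s t) \<alpha> =
     (if Poly_Mapping.lookup \<alpha> (s, t) = 0 then 0
      else Poly_Mapping.lookup q (\<alpha> - Poly_Mapping.single (s, t) 1))"
proof (rule additive_poly_mapping_eqI[where p = q])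
  fix \<beta> :: power_prod and d :: complex
  \<comment> \<open>Subtraction of exponents is truncated, so solving for \<beta> is valid only if
    x_st occurs in \<alpha>.\<close>
  have "\<beta> + Poly_Mapping.single (s, t) 1 = \<alpha> \<longleftrightarrow>
      Poly_Mapping.lookup \<alpha> (s, t) \<noteq> 0 \<and> \<beta> = \<alpha> - Poly_Mapping.single (s, t) 1"
  proof
    assume R: "Poly_Mapping.lookup \<alpha> (s, t) \<noteq> 0 \<and> \<beta> = \<alpha> - Poly_Mapping.single (s, t) 1"
    then show "\<beta> + Poly_Mapping.single (s, t) 1 = \<alpha>"
      by (intro poly_mapping_eqI) (auto simp: lookup_add lookup_minus lookup_single when_def)
  qed (auto simp: lookup_add)
  then show "Poly_Mapping.lookup (Poly_Mapping.single \<beta> d * xv s t) \<alpha> =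
      (if Poly_Mapping.lookup \<alpha> (s, t) = 0 then 0
       else Poly_Mapping.lookup (Poly_Mapping.single \<beta> d) (\<alpha> - Poly_Mapping.single (s, t) 1))"
    by (auto simp: xv_def mult_single lookup_single when_def)
qed (simp_all add: distrib_right lookup_add)

text \<open>The coefficient of \<open>x\<^bsub>ij\<^esub>\<^sup>a x\<^bsub>kp\<^esub> r\<^bsub>ijk\<^esub>\<close> in the normal form: modulo \<open>im \<Psi>\<close> one has
  \<open>x\<^bsub>kp\<^esub> r\<^bsub>ijk\<^esub> = x\<^bsub>ij\<^esub> r\<^bsub>ikp\<^esub> = - x\<^bsub>ij\<^esub> r\<^bsub>jkp\<^esub>\<close>, and this term also occurs in the reductions of
  \<open>x\<^bsub>ip\<^esub> r\<^bsub>ijk\<^esub>\<close> and \<open>x\<^bsub>jk\<^esub> r\<^bsub>ijp\<^esub>\<close>.\<close>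

definition torsion_coeff :: "nat \<Rightarrow> nat \<Rightarrow> nat \<Rightarrow> nat \<Rightarrow> nat \<Rightarrow> cvec \<Rightarrow> complex" where
  "torsion_coeff a i j k p f =
     (let E = (\<lambda>w b. Poly_Mapping.lookup (Poly_Mapping.lookup f b)
                (Poly_Mapping.single (i, j) a + Poly_Mapping.single w 1))
      in E (k, p) (i, j, k) - E (i, p) (i, j, k) + E (j, k) (i, j, p)
         + E (i, j) (i, k, p) - E (i, j) (j, k, p))"

lemma torsion_coeff_add: "torsion_coeff a i j k p (f + g) = torsion_coeff a i j k p f + torsion_coeff a i j k p g"
  by (simp add: torsion_coeff_def Let_def lookup_add)

lemma torsion_coeff_minus:
  "torsion_coeff a i j k p (- f) = - torsion_coeff a i j k p f"
  "torsion_coeff a i j k p (f - g) = torsion_coeff a i j k p f - torsion_coeff a i j k p g"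
  by (simp_all add: torsion_coeff_def Let_def lookup_minus)

text \<open>The value of \<open>torsion_coeff\<close> on x_ij^a x_v r_b when v is not the pair of
  the first two indices of b. It is independent of a, so one finite table of signs settles all
  powers of x_ij.\<close>

definition torsion_sign ::
    "nat \<Rightarrow> nat \<Rightarrow> nat \<Rightarrow> nat \<Rightarrow> nat \<times> nat \<times> nat \<Rightarrow> nat \<times> nat \<Rightarrow> complex" where
  "torsion_sign i j k p b v =
     (if b = (i, j, k) \<and> v = (k, p) \<or> b = (i, j, p) \<and> v = (j, k) \<or> b = (i, k, p) \<and> v = (i, j) then 1
      else if b = (i, j, k) \<and> v = (i, p) \<or> b = (j, k, p) \<and> v = (i, j) then - 1 else 0)"

text \<open>In the excluded case x_st is x_ij and w is another variable. For a > 0, x_st then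
  divides x_ij^a x_w although w is not (s, t).\<close>

lemma lookup_mult_xv_power:
  assumes "w = (i, j) \<or> (s, t) \<noteq> (i, j)"
  shows "Poly_Mapping.lookup (q * xv s t) (Poly_Mapping.single (i, j) a + Poly_Mapping.single w 1) =
     (if w = (s, t) then Poly_Mapping.lookup q (Poly_Mapping.single (i, j) a) else 0)"
  using assms by (auto simp: lookup_mult_xv lookup_add lookup_single when_def split: if_splits)

text \<open>The side condition holds for every term of the generators, where x_i'j' never multiplies
  r_i'j'k'. It keeps x_st different from x_ij on r_ijk and r_ijp; on r_ikp and r_jkp the functional
  reads a pure power of x_ij, for which every (s, t) is allowed.\<close>

lemma torsion_coeff_rb:
  assumes "p < k" "k < j" "j < i" and st: "s = i' \<longrightarrow> t \<noteq> j'"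
  shows "torsion_coeff a i j k p ((q * xv s t) \<odot>\<^sub>F rb i' j' k') =
     Poly_Mapping.lookup q (Poly_Mapping.single (i, j) a) * torsion_sign i j k p (i', j', k') (s, t)"
proof (cases "i' = i \<and> j' = j")
  case True
  then have "(s, t) \<noteq> (i, j)"
    using st by simp
  with True assms(1-3) show ?thesis
    by (simp add: torsion_coeff_def torsion_sign_def Let_def lookup_rb lookup_mult_xv_power[unfolded One_nat_def])
next
  case False
  with assms(1-3) show ?thesis
    by (simp add: torsion_coeff_def torsion_sign_def Let_def lookup_rb lookup_mult_xv_power[unfolded One_nat_def]) auto
qed

text \<open>One identity for each of the first five families in \<open>B_set\<close>: the functional
  takes q times such a generator to the coefficient of x_ij^a in q times the difference of the two
  sides.\<close>

lemma torsion_sign_relations: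
  assumes "p < k" "k < j" "j < i" and "k' < j'" "j' < i'"
  shows "k' < l \<Longrightarrow> l < j' \<Longrightarrow> torsion_sign i j k p (i', j', k') (j', l) =
      torsion_sign i j k p (i', j', l) (j', k') + torsion_sign i j k p (i', j', l) (l, k')"
    and "k' < l \<Longrightarrow> l < j' \<Longrightarrow> torsion_sign i j k p (i', j', k') (i', l) =
      - torsion_sign i j k p (i', j', l) (j', k')"
    and "j' < l \<Longrightarrow> l < i' \<Longrightarrow> torsion_sign i j k p (i', j', k') (i', l) =
      torsion_sign i j k p (i', l, j') (j', k')"
    and "i' < l \<Longrightarrow> torsion_sign i j k p (i', j', k') (l, i') =
      - torsion_sign i j k p (l, i', j') (j', k')"
    and "l < k' \<Longrightarrow> torsion_sign i j k p (i', j', k') (i', l) =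
      - torsion_sign i j k p (i', j', k') (j', l) - torsion_sign i j k p (i', j', k') (k', l)"
  unfolding torsion_sign_def prod.inject
  subgoal using assms by (cases "i' = i"; cases "j' = j"; cases "l = k"; simp)
  subgoal using assms by (cases "i' = i"; cases "j' = j"; cases "l = k"; simp)
  subgoal using assms by (cases "i' = i"; cases "l = j"; cases "j' = k"; simp)
  subgoal using assms by (cases "l = i"; cases "i' = j"; cases "j' = k"; simp)
  subgoal using assms by (cases "i' = i"; cases "j' = j"; cases "k' = k"; simp)
  done

text \<open>In the five terms that the functional reads, the second index of the variable is never
  the second or third index of the basis element, and the variable always shares an index with the
  basis element. This settles the remaining families of \<open>B_set\<close>.\<close>

lemma torsion_sign_eq_0:
  assumes "p < k" "k < j" "j < i" and "k' < j'" "j' < i'"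
  shows "k' < s \<Longrightarrow> torsion_sign i j k p (i', j', k') (s, k') = 0"
    and "s \<noteq> i' \<Longrightarrow> torsion_sign i j k p (i', j', k') (s, j') = 0"
    and "{s, t} \<inter> {i', j', k'} = {} \<Longrightarrow> torsion_sign i j k p (i', j', k') (s, t) = 0"
  using assms unfolding torsion_sign_def prod.inject
  by (cases "i' = i"; cases "j' = j"; cases "k' = k"; auto)+

lemma torsion_coeff_B_set:
  assumes "(i', j', k') \<in> basis_indices n" and "b \<in> B_set n i' j' k'"
    and pkji: "p < k" "k < j" "j < i"
  shows "torsion_coeff a i j k p (q \<odot>\<^sub>F b) = 0"
proof -
  have idx: "1 \<le> k'" "k' < j'" "j' < i'"
    using assms(1) by (auto simp: basis_indices_def)
  note expand = scale_vec_simps distrib_left right_diff_distrib torsion_coeff_add torsion_coeff_minus torsion_coeff_rb[OF pkji]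
  note coeff = torsion_sign_relations[OF pkji idx(2,3)] torsion_sign_eq_0[OF pkji idx(2,3)]
  have "b \<in> B_set n i' j' k' \<Longrightarrow> k' < j' \<Longrightarrow> j' < i' \<Longrightarrow> ?thesis"
    unfolding B_set_def
    by (elim UnE CollectE exE conjE singletonE; hypsubst; simp add: expand coeff algebra_simps)
  then show ?thesis
    using assms(2) idx by blast
qed

section \<open>Leading terms\<close>

text \<open>Makes the variable order visibly well-founded, so that a smallest variable at which two
  exponent vectors differ can be chosen.\<close>

lemma var_greater_iff: "var_greater v w \<longleftrightarrow> (w, v) \<in> less_than <*lex*> less_than"
  by (auto simp: var_greater_def split: prod.splits)

lemma var_greater_trans: "var_greater u v \<Longrightarrow> var_greater v w \<Longrightarrow> var_greater u w"
  by (auto simp: var_greater_def split: prod.splits)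

lemma var_greater_total: "v \<noteq> w \<Longrightarrow> var_greater v w \<or> var_greater w v"
  by (auto simp: var_greater_def split: prod.splits)

lemma power_prod_greater_irrefl: "\<not> power_prod_greater \<alpha> \<alpha>"
  by (simp add: power_prod_greater_def)

lemma power_prod_greater_trans:
  assumes "power_prod_greater \<alpha> \<beta>" "power_prod_greater \<beta> \<gamma>"
  shows "power_prod_greater \<alpha> \<gamma>"
proof (cases "total_deg \<alpha> = total_deg \<beta> \<and> total_deg \<beta> = total_deg \<gamma>")
  case True
  with assms obtain u v where
    u: "Poly_Mapping.lookup \<alpha> u < Poly_Mapping.lookup \<beta> u"
      "\<And>w. var_greater u w \<Longrightarrow> Poly_Mapping.lookup \<alpha> w = Poly_Mapping.lookup \<beta> w" and
    v: "Poly_Mapping.lookup \<beta> v < Poly_Mapping.lookup \<gamma> v"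
      "\<And>w. var_greater v w \<Longrightarrow> Poly_Mapping.lookup \<beta> w = Poly_Mapping.lookup \<gamma> w"
    by (auto simp: power_prod_greater_def)
  \<comment> \<open>The smaller of u and v decides between \<alpha> and \<gamma>, since all three
    exponent vectors agree below it.\<close>
  consider "u = v" | "var_greater u v" | "var_greater v u"
    using var_greater_total by blast
  then have "\<exists>v. Poly_Mapping.lookup \<alpha> v < Poly_Mapping.lookup \<gamma> v \<and>
      (\<forall>w. var_greater v w \<longrightarrow> Poly_Mapping.lookup \<alpha> w = Poly_Mapping.lookup \<gamma> w)"
  proof cases
    case 1
    then show ?thesis
      using u v by (intro exI[of _ v]) auto
  next
    case 2
    then show ?thesis
      using u v var_greater_trans by (intro exI[of _ v]) metis
  next
    case 3
    then show ?thesis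
      using u v var_greater_trans by (intro exI[of _ u]) metis
  qed
  with True show ?thesis
    by (simp add: power_prod_greater_def)
qed (use assms in \<open>auto simp: power_prod_greater_def\<close>)

lemma power_prod_greater_total:
  assumes "\<alpha> \<noteq> \<beta>"
  shows "power_prod_greater \<alpha> \<beta> \<or> power_prod_greater \<beta> \<alpha>"
proof -
  let ?D = "{v. Poly_Mapping.lookup \<alpha> v \<noteq> Poly_Mapping.lookup \<beta> v}"
  have "wf (less_than <*lex*> less_than)"
    by auto
  moreover have "?D \<noteq> {}"
    using assms by (auto intro: poly_mapping_eqI)
  \<comment> \<open>The smallest variable at which the exponents differ decides when the degrees are
    equal.\<close>
  ultimately obtain v where "v \<in> ?D" "\<And>w. var_greater v w \<Longrightarrow> w \<notin> ?D"
    unfolding var_greater_iff by (metis (no_types, lifting) wfE_min')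
  then show ?thesis
    unfolding power_prod_greater_def by (smt (verit) linorder_neqE_nat mem_Collect_eq)
qed

lemma term_greater_irrefl: "\<not> term_greater u u"
  by (auto simp: term_greater_def basis_greater_def power_prod_greater_irrefl split: prod.splits)

lemma term_greater_trans: "term_greater u v \<Longrightarrow> term_greater v w \<Longrightarrow> term_greater u w"
  unfolding term_greater_def
  by (auto simp: basis_greater_def split: prod.splits intro: power_prod_greater_trans)

lemma term_greater_total: "u \<noteq> v \<Longrightarrow> term_greater u v \<or> term_greater v u"
proof -
  assume uv: "u \<noteq> v"
  obtain \<alpha> b \<beta> c where eq: "u = (\<alpha>, b)" "v = (\<beta>, c)"
    by (cases u, cases v)
  have "b \<noteq> c \<Longrightarrow> basis_greater b c \<or> basis_greater c b"
    by (auto simp: basis_greater_def split: prod.splits)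
  moreover have "b = c \<Longrightarrow> power_prod_greater \<alpha> \<beta> \<or> power_prod_greater \<beta> \<alpha>"
    using uv eq by (auto intro: power_prod_greater_total[THEN disjE])
  ultimately show ?thesis
    unfolding eq term_greater_def by blast
qed

section \<open>Leading terms of vectors\<close>

definition is_leading_term :: "cvec \<Rightarrow> power_prod \<times> nat \<times> nat \<times> nat \<Rightarrow> bool" where
  "is_leading_term f u \<longleftrightarrow> u \<in> vec_terms f \<and> (\<forall>w\<in>vec_terms f. w \<noteq> u \<longrightarrow> term_greater u w)"

lemma vec_terms_iff: "(\<alpha>, b) \<in> vec_terms f \<longleftrightarrow> Poly_Mapping.lookup (Poly_Mapping.lookup f b) \<alpha> \<noteq> 0"
  by (simp add: vec_terms_def in_keys_iff)

lemma finite_vec_terms: "finite (vec_terms f)"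
proof (rule finite_subset)
  show "vec_terms f \<subseteq> (\<Union>b\<in>Poly_Mapping.keys f.
      (\<lambda>\<alpha>. (\<alpha>, b)) ` Poly_Mapping.keys (Poly_Mapping.lookup f b))"
  proof clarify
    fix \<alpha> i j k
    assume "(\<alpha>, i, j, k) \<in> vec_terms f"
    then have "\<alpha> \<in> Poly_Mapping.keys (Poly_Mapping.lookup f (i, j, k))"
      by (simp add: vec_terms_def)
    moreover from this have "(i, j, k) \<in> Poly_Mapping.keys f"
      by (auto simp: in_keys_iff)
    ultimately show "(\<alpha>, i, j, k) \<in> (\<Union>b\<in>Poly_Mapping.keys f.
        (\<lambda>\<alpha>. (\<alpha>, b)) ` Poly_Mapping.keys (Poly_Mapping.lookup f b))"
      by blast
  qed
qed simp

lemma is_leading_term_exists: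
  assumes "f \<noteq> 0"
  shows "\<exists>u. is_leading_term f u"
proof -
  have "\<exists>u\<in>A. \<forall>w\<in>A. w \<noteq> u \<longrightarrow> term_greater u w" if "finite A" "A \<noteq> {}" for A
    using that
  proof (induction A rule: finite_ne_induct)
    case (insert x A)
    then obtain u where u: "u \<in> A" "\<And>w. w \<in> A \<Longrightarrow> w \<noteq> u \<Longrightarrow> term_greater u w"
      by blast
    show ?case
    proof (cases "term_greater x u")
      case True
      have "term_greater x w" if "w \<in> insert x A" "w \<noteq> x" for w
        using that u(2)[of w] True term_greater_trans[OF True, of w] by (cases "w = u") simp_all
      then show ?thesis
        by blast
    next
      case False
      then show ?thesis
        using u insert.hyps term_greater_total[of x u] by (intro bexI[of _ u]) auto
    qed
  qed simp
  moreover have "vec_terms f \<noteq> {}"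
  proof -
    obtain b where "Poly_Mapping.lookup f b \<noteq> 0"
      using assms by (metis lookup_zero poly_mapping_eqI)
    then obtain \<alpha> where "Poly_Mapping.lookup (Poly_Mapping.lookup f b) \<alpha> \<noteq> 0"
      by (metis lookup_zero poly_mapping_eqI)
    then show ?thesis
      using vec_terms_iff by blast
  qed
  ultimately show ?thesis
    unfolding is_leading_term_def using finite_vec_terms by blast
qed

text \<open>Irreflexivity and transitivity of the term order make the leading term unique, which
  determines the description in \<open>initial_term\<close>.\<close>

lemma initial_term_eq:
  assumes "is_leading_term f (\<alpha>, b)"
  shows "initial_term f =
    Poly_Mapping.single b (Poly_Mapping.single \<alpha> (Poly_Mapping.lookup (Poly_Mapping.lookup f b) \<alpha>))"
proof -
  have "(THE u. u \<in> vec_terms f \<and> (\<forall>w\<in>vec_terms f. w \<noteq> u \<longrightarrow> term_greater u w)) = (\<alpha>, b)"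
  proof (rule the_equality)
    fix u assume u: "u \<in> vec_terms f \<and> (\<forall>w\<in>vec_terms f. w \<noteq> u \<longrightarrow> term_greater u w)"
    show "u = (\<alpha>, b)"
    proof (rule ccontr)
      assume "u \<noteq> (\<alpha>, b)"
      then have "term_greater u (\<alpha>, b)" "term_greater (\<alpha>, b) u"
        using u assms unfolding is_leading_term_def by simp_all
      then show False
        using term_greater_trans term_greater_irrefl by blast
    qed
  qed (use assms in \<open>simp add: is_leading_term_def\<close>)
  moreover have "f \<noteq> 0"
    using assms by (auto simp: is_leading_term_def vec_terms_iff)
  ultimately show ?thesis
    by (simp add: initial_term_def)
qed

lemma initial_term_add:
  assumes "c \<noteq> 0" and "\<And>w. w \<in> vec_terms h \<Longrightarrow> term_greater (\<alpha>, b) w"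
  shows "initial_term (Poly_Mapping.single b (Poly_Mapping.single \<alpha> c) + h) =
    Poly_Mapping.single b (Poly_Mapping.single \<alpha> c)"
proof -
  let ?f = "Poly_Mapping.single b (Poly_Mapping.single \<alpha> c) + h"
  have "(\<alpha>, b) \<notin> vec_terms h"
    using assms(2) term_greater_irrefl by blast
  then have "Poly_Mapping.lookup (Poly_Mapping.lookup h b) \<alpha> = 0"
    by (simp add: vec_terms_iff)
  moreover have "w \<in> vec_terms h" if "w \<in> vec_terms ?f" "w \<noteq> (\<alpha>, b)" for w
    using that by (cases w) (auto simp: vec_terms_iff lookup_add lookup_single when_def split: if_splits)
  ultimately have "is_leading_term ?f (\<alpha>, b)"
    using assms by (auto simp: is_leading_term_def vec_terms_iff lookup_add)
  then show ?thesis
    using \<open>Poly_Mapping.lookup (Poly_Mapping.lookup h b) \<alpha> = 0\<close>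
    by (simp add: initial_term_eq lookup_add)
qed

section \<open>Initial terms of the linear generators\<close>

lemma total_deg_add: "total_deg (\<alpha> + \<beta>) = total_deg \<alpha> + total_deg \<beta>"
  unfolding total_deg_def by (rule setsum_keys_plus_distrib) simp_all

lemma total_deg_single [simp]: "total_deg (Poly_Mapping.single v m) = m"
  by (simp add: total_deg_def)

lemma power_prod_greater_var:
  assumes "var_greater v w"
  shows "power_prod_greater (Poly_Mapping.single v 1) (Poly_Mapping.single w 1)"
  unfolding power_prod_greater_def
  using assms
  by (intro disjI2 conjI exI[of _ w])
    (auto simp: lookup_single when_def var_greater_def split: prod.splits)

lemma xv_rb: "xv s t \<odot>\<^sub>F rb i j k =
    Poly_Mapping.single (i, j, k) (Poly_Mapping.single (Poly_Mapping.single (s, t) 1) 1)"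
  by (rule poly_mapping_eqI) (auto simp: lookup_rb xv_def lookup_single when_def)

lemma vec_terms_add: "vec_terms (f + g) \<subseteq> vec_terms f \<union> vec_terms g"
  by (auto simp: vec_terms_iff lookup_add)

lemma vec_terms_diff: "vec_terms (f - g) \<subseteq> vec_terms f \<union> vec_terms g"
  by (auto simp: vec_terms_iff lookup_minus)

lemma vec_terms_minus [simp]: "vec_terms (- f) = vec_terms f"
  by (auto simp: vec_terms_iff)

lemma vec_terms_xv_rb: "vec_terms (xv s t \<odot>\<^sub>F rb i j k) = {(Poly_Mapping.single (s, t) 1, (i, j, k))}"
  by (auto simp: xv_rb vec_terms_iff lookup_single when_def split: if_splits)

lemma initial_term_xv_add:
  assumes "\<And>w. w \<in> vec_terms h \<Longrightarrow> term_greater (Poly_Mapping.single (s, t) 1, i, j, k) w"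
  shows "initial_term (xv s t \<odot>\<^sub>F rb i j k + h) = xv s t \<odot>\<^sub>F rb i j k"
  unfolding xv_rb using assms by (intro initial_term_add) auto

lemma initial_term_xv: "initial_term (xv s t \<odot>\<^sub>F rb i j k) = xv s t \<odot>\<^sub>F rb i j k"
  using initial_term_xv_add[of 0 s t i j k] by (simp add: vec_terms_def)

lemma B_setI:
  "k < l \<Longrightarrow> l < j \<Longrightarrow>
    (- xv j k - xv l k) \<odot>\<^sub>F rb i j l + xv j l \<odot>\<^sub>F rb i j k \<in> B_set n i j k"
  "k < l \<Longrightarrow> l < j \<Longrightarrow> xv j k \<odot>\<^sub>F rb i j l + xv i l \<odot>\<^sub>F rb i j k \<in> B_set n i j k"
  "j < l \<Longrightarrow> l < i \<Longrightarrow> - xv j k \<odot>\<^sub>F rb i l j + xv i l \<odot>\<^sub>F rb i j k \<in> B_set n i j k"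
  "i < l \<Longrightarrow> l \<le> n \<Longrightarrow> xv j k \<odot>\<^sub>F rb l i j + xv l i \<odot>\<^sub>F rb i j k \<in> B_set n i j k"
  "1 \<le> l \<Longrightarrow> l < k \<Longrightarrow> (xv i l + xv j l + xv k l) \<odot>\<^sub>F rb i j k \<in> B_set n i j k"
  "(xv i k + xv j k) \<odot>\<^sub>F rb i j k \<in> B_set n i j k"
  "k < l \<Longrightarrow> l < j \<Longrightarrow> xv l k \<odot>\<^sub>F rb i j k \<in> B_set n i j k"
  "j < l \<Longrightarrow> l < i \<Longrightarrow> xv l k \<odot>\<^sub>F rb i j k \<in> B_set n i j k"
  "j < l \<Longrightarrow> l < i \<Longrightarrow> xv l j \<odot>\<^sub>F rb i j k \<in> B_set n i j k"
  "i < l \<Longrightarrow> l \<le> n \<Longrightarrow> xv l k \<odot>\<^sub>F rb i j k \<in> B_set n i j k"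
  "i < l \<Longrightarrow> l \<le> n \<Longrightarrow> xv l j \<odot>\<^sub>F rb i j k \<in> B_set n i j k"
  "1 \<le> t \<Longrightarrow> t < s \<Longrightarrow> s \<le> n \<Longrightarrow> {s, t} \<inter> {i, j, k} = {} \<Longrightarrow>
    xv s t \<odot>\<^sub>F rb i j k \<in> B_set n i j k"
  unfolding B_set_def
  by ((rule UnI2, rule singletonI
    | rule UnI2, rule CollectI, (rule exI)+, intro conjI, rule refl, assumption+
    | rule UnI1
    | rule CollectI, (rule exI)+, intro conjI, rule refl, assumption+)+)

text \<open>The excluded variables x_ij, x_jq with q \<le> k, and x_kp are those of the standard
  terms on r_ijk. Every other variable stands on r_ijk in some generator whose other terms lie on
  smaller basis elements or carry smaller variables.\<close>

lemma B_set_initial_term: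
  assumes ijk: "(i, j, k) \<in> basis_indices n" and st: "(s, t) \<in> var_indices n"
    and nonfree: "(s, t) \<noteq> (i, j)" "s = j \<longrightarrow> k < t" "s \<noteq> k"
  shows "\<exists>g\<in>B_set n i j k. initial_term g = xv s t \<odot>\<^sub>F rb i j k"
proof -
  have idx: "1 \<le> k" "k < j" "j < i" "i \<le> n" "1 \<le> t" "t < s" "s \<le> n"
    using ijk st by (auto simp: basis_indices_def var_indices_def)
  have var: "term_greater (Poly_Mapping.single u 1, i, j, k) (Poly_Mapping.single v 1, i, j, k)"
    if "var_greater u v" for u v
    using power_prod_greater_var[OF that] by (simp add: term_greater_def)
  have single: ?thesis if "xv s t \<odot>\<^sub>F rb i j k \<in> B_set n i j k"
    using that initial_term_xv by blast
  consider "s = j" "k < t" | "s = i" "t < k" | "s = i" "t = k" | "s = i" "k < t" "t < j"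
    | "s = i" "j < t" | "t = i" | "t = k" "s \<noteq> i" "s \<noteq> j" | "t = j" "s \<noteq> i"
    | "s \<notin> {i, j, k}" "t \<notin> {i, j, k}"
    using nonfree by (metis empty_iff insert_iff linorder_neqE_nat)
  then show ?thesis
  proof cases
    case 1
    \<comment> \<open>Since k < t, r_ijt is below r_ijk; basis elements are compared first, so the
      monomials on r_ijt have no influence.\<close>
    let ?g = "(- xv j k - xv t k) \<odot>\<^sub>F rb i j t + xv j t \<odot>\<^sub>F rb i j k"
    have "?g = xv s t \<odot>\<^sub>F rb i j k + (- (xv j k \<odot>\<^sub>F rb i j t) - xv t k \<odot>\<^sub>F rb i j t)"
      using 1 by (simp add: scale_vec_simps)
    also have "initial_term \<dots> = xv s t \<odot>\<^sub>F rb i j k"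
      using 1 by (intro initial_term_xv_add)
        (auto dest!: vec_terms_diff[THEN subsetD] simp: vec_terms_xv_rb term_greater_def basis_greater_def)
    finally show ?thesis
      using 1 idx by (intro bexI[of _ ?g]) (simp_all add: B_setI del: One_nat_def)
  next
    case 2
    \<comment> \<open>All three terms lie on r_ijk, and x_it is the largest variable because i > j >
      k.\<close>
    let ?g = "(xv i t + xv j t + xv k t) \<odot>\<^sub>F rb i j k"
    have "?g = xv s t \<odot>\<^sub>F rb i j k + (xv j t \<odot>\<^sub>F rb i j k + xv k t \<odot>\<^sub>F rb i j k)"
      using 2 by (simp add: scale_vec_simps)
    also have "initial_term \<dots> = xv s t \<odot>\<^sub>F rb i j k"
      using 2 idx by (intro initial_term_xv_add)
        (auto dest!: vec_terms_add[THEN subsetD] simp: vec_terms_xv_rb var_greater_def intro!: var[unfolded One_nat_def])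
    finally show ?thesis
      using 2 idx by (intro bexI[of _ ?g]) (simp_all add: B_setI del: One_nat_def)
  next
    case 3
    let ?g = "(xv i k + xv j k) \<odot>\<^sub>F rb i j k"
    have "?g = xv s t \<odot>\<^sub>F rb i j k + xv j k \<odot>\<^sub>F rb i j k"
      using 3 by (simp add: scale_vec_simps)
    also have "initial_term \<dots> = xv s t \<odot>\<^sub>F rb i j k"
      using 3 idx by (intro initial_term_xv_add)
        (auto simp: vec_terms_xv_rb var_greater_def intro!: var[unfolded One_nat_def])
    finally show ?thesis
      by (intro bexI[of _ ?g]) (simp_all add: B_setI del: One_nat_def)
  next
    case 4
    let ?g = "xv j k \<odot>\<^sub>F rb i j t + xv i t \<odot>\<^sub>F rb i j k"
    have "?g = xv s t \<odot>\<^sub>F rb i j k + xv j k \<odot>\<^sub>F rb i j t"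
      using 4 by simp
    also have "initial_term \<dots> = xv s t \<odot>\<^sub>F rb i j k"
      using 4 by (intro initial_term_xv_add)
        (auto simp: vec_terms_xv_rb term_greater_def basis_greater_def)
    finally show ?thesis
      using 4 idx by (intro bexI[of _ ?g]) (simp_all add: B_setI del: One_nat_def)
  next
    case 5
    let ?g = "- xv j k \<odot>\<^sub>F rb i t j + xv i t \<odot>\<^sub>F rb i j k"
    have "?g = xv s t \<odot>\<^sub>F rb i j k + - (xv j k \<odot>\<^sub>F rb i t j)"
      using 5 by (simp add: scale_vec_simps)
    also have "initial_term \<dots> = xv s t \<odot>\<^sub>F rb i j k"
      using 5 by (intro initial_term_xv_add)
        (auto simp: vec_terms_xv_rb term_greater_def basis_greater_def)
    finally show ?thesis
      using 5 idx by (intro bexI[of _ ?g]) (simp_all add: B_setI del: One_nat_def)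
  next
    case 6
    let ?g = "xv j k \<odot>\<^sub>F rb s i j + xv s i \<odot>\<^sub>F rb i j k"
    have "?g = xv s t \<odot>\<^sub>F rb i j k + xv j k \<odot>\<^sub>F rb s i j"
      using 6 by simp
    also have "initial_term \<dots> = xv s t \<odot>\<^sub>F rb i j k"
      using 6 idx by (intro initial_term_xv_add)
        (auto simp: vec_terms_xv_rb term_greater_def basis_greater_def)
    finally show ?thesis
      using 6 idx by (intro bexI[of _ ?g]) (simp_all add: B_setI del: One_nat_def)
  next
    case 7
    then have "k < s \<and> s < j \<or> j < s \<and> s < i \<or> i < s"
      using idx by linarith
    then show ?thesis
      using 7 idx by (intro single) (auto intro: B_setI)
  next
    case 8
    then have "j < s \<and> s < i \<or> i < s"
      using idx by linarith
    then show ?thesis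
      using 8 idx by (intro single) (auto intro: B_setI)
  next
    case 9
    then show ?thesis
      using idx by (intro single) (auto intro: B_setI)
  qed
qed

section \<open>The standard terms are not leading terms\<close>

lemma im_Psi_generators_closed:
  "(\<Union>(i, j, k)\<in>basis_indices n. B_set n i j k) \<subseteq> carrier (F_module n)"
  using G_set_closed unfolding G_set_def by blast

lemma im_Psi_submodule: "submodule (im_Psi n) (S_ring n) (F_module n)"
  unfolding im_Psi_def by (rule submodule_generated_submodule[OF im_Psi_generators_closed])

lemma im_Psi_closed: "im_Psi n \<subseteq> carrier (F_module n)"
  using module.submoduleE(1)[OF module_F_module im_Psi_submodule] .

lemma row_map_im_Psi:
  assumes "f \<in> im_Psi n" "j < i"
  shows "row_map i j f = 0"
proof (rule functional_vanishes[OF im_Psi_generators_closed row_map_add])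
  show "f \<in> generated_submodule n (\<Union>(i, j, k)\<in>basis_indices n. B_set n i j k)"
    using assms by (simp add: im_Psi_def)
qed (use assms(2) row_map_B_set in blast)

lemma torsion_coeff_im_Psi:
  assumes "f \<in> im_Psi n" "p < k" "k < j" "j < i"
  shows "torsion_coeff a i j k p f = 0"
proof (rule functional_vanishes[OF im_Psi_generators_closed torsion_coeff_add])
  show "f \<in> generated_submodule n (\<Union>(i, j, k)\<in>basis_indices n. B_set n i j k)"
    using assms by (simp add: im_Psi_def)
qed (use assms torsion_coeff_B_set in blast)

lemma term_greater_basis: "basis_greater b c \<Longrightarrow> term_greater (\<alpha>, b) (\<beta>, c)"
  by (simp add: term_greater_def)

lemma leading_term_lookup_eq_0:
  assumes "is_leading_term f (\<alpha>, b)" and "term_greater (\<beta>, c) (\<alpha>, b)"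
  shows "Poly_Mapping.lookup (Poly_Mapping.lookup f c) \<beta> = 0"
proof (rule ccontr)
  assume "Poly_Mapping.lookup (Poly_Mapping.lookup f c) \<beta> \<noteq> 0"
  then have "(\<beta>, c) \<in> vec_terms f"
    by (simp add: vec_terms_iff)
  then show False
    using assms term_greater_irrefl term_greater_trans unfolding is_leading_term_def by metis
qed

section \<open>Leading monomials under the row homomorphism\<close>

lemma total_deg_rename: "total_deg (rename \<rho> \<alpha>) = total_deg \<alpha>"
  by (rule additive_poly_mapping_eqI[where p = \<alpha>]) (simp_all add: rename_add total_deg_add)

lemma rename_id: "(\<And>v. Poly_Mapping.lookup \<alpha> v \<noteq> 0 \<Longrightarrow> \<rho> v = v) \<Longrightarrow> rename \<rho> \<alpha> = \<alpha>"
  unfolding rename_def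
  by (subst (2) poly_mapping_expand[of \<alpha>]) (auto intro!: sum.cong simp: in_keys_iff)

lemma weight_eq_1: "(\<And>v. Poly_Mapping.lookup \<alpha> v \<noteq> 0 \<Longrightarrow> c v = 1) \<Longrightarrow> weight c \<alpha> = 1"
  unfolding weight_def by (auto intro!: prod.neutral simp: in_keys_iff)

lemma lookup_rename_row:
  assumes "j < i"
  shows "t < j \<Longrightarrow> Poly_Mapping.lookup (rename (row_index i j) \<gamma>) (j, t) =
      Poly_Mapping.lookup \<gamma> (j, t) + Poly_Mapping.lookup \<gamma> (i, t)"
    and "Poly_Mapping.lookup (rename (row_index i j) \<gamma>) (i, j) = Poly_Mapping.lookup \<gamma> (i, j)"
proof -
  show "Poly_Mapping.lookup (rename (row_index i j) \<gamma>) (j, t) =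
      Poly_Mapping.lookup \<gamma> (j, t) + Poly_Mapping.lookup \<gamma> (i, t)" if "t < j"
    using assms that
    by (intro additive_poly_mapping_eqI[where p = \<gamma>
          and f = "\<lambda>\<gamma>. Poly_Mapping.lookup (rename (row_index i j) \<gamma>) (j, t)"
          and g = "\<lambda>\<gamma>. Poly_Mapping.lookup \<gamma> (j, t) + Poly_Mapping.lookup \<gamma> (i, t)"])
      (auto simp: rename_add lookup_add lookup_single when_def split: if_splits)
  show "Poly_Mapping.lookup (rename (row_index i j) \<gamma>) (i, j) = Poly_Mapping.lookup \<gamma> (i, j)"
    using assms
    by (intro additive_poly_mapping_eqI[where p = \<gamma>
          and f = "\<lambda>\<gamma>. Poly_Mapping.lookup (rename (row_index i j) \<gamma>) (i, j)"
          and g = "\<lambda>\<gamma>. Poly_Mapping.lookup \<gamma> (i, j)"])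
      (auto simp: rename_add lookup_add lookup_single when_def split: if_splits)
qed

text \<open>The substitution preserves the degree and, on monomials that it does not kill, only
  moves exponents from x_it to the smaller variable x_jt. Hence it never produces a larger
  monomial.\<close>

lemma rename_row_not_smaller:
  assumes ji: "j < i" and ren: "rename (row_index i j) \<gamma> = \<alpha>"
    and wt: "weight (row_sign i j) \<gamma> \<noteq> 0"
  shows "\<not> power_prod_greater \<alpha> \<gamma>"
proof
  assume greater: "power_prod_greater \<alpha> \<gamma>"
  have "total_deg \<alpha> = total_deg \<gamma>"
    using total_deg_rename[of "row_index i j" \<gamma>] by (simp only: ren)
  with greater obtain s t where st: "Poly_Mapping.lookup \<alpha> (s, t) < Poly_Mapping.lookup \<gamma> (s, t)"
    and below: "\<And>w. var_greater (s, t) w \<Longrightarrow> Poly_Mapping.lookup \<alpha> w = Poly_Mapping.lookup \<gamma> w"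
    by (auto simp: power_prod_greater_def)
  have "row_sign i j (s, t) \<noteq> 0"
    by (rule weight_nonzeroD[OF wt]) (use st in simp)
  then consider "s = i" "t < j" | "s = j" "t < j" | "s = i" "t = j"
    by (auto split: if_splits)
  then show False
  proof cases
    case 1
    \<comment> \<open>As x_jt is below x_it, its exponents in \<alpha> and \<gamma> agree; yet
      renaming has raised it by the positive exponent of x_it in \<gamma>.\<close>
    then have "Poly_Mapping.lookup \<alpha> (j, t) = Poly_Mapping.lookup \<gamma> (j, t)"
      using ji by (intro below) (simp add: var_greater_def)
    then show False
      using 1 st ren lookup_rename_row(1)[OF ji, of t \<gamma>] by simp
  next
    case 2
    then show False
      using st ren lookup_rename_row(1)[OF ji, of t \<gamma>] by simp
  next
    case 3
    then show False
      using st ren lookup_rename_row(2)[OF ji, of \<gamma>] by simp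
  qed
qed

text \<open>The substitution fixes \<alpha> with weight 1, and by
  \<open>rename_row_not_smaller\<close> a smaller monomial is either killed or not sent to
  \<alpha>.\<close>

lemma lookup_row_subst_leading:
  assumes ji: "j < i" and \<alpha>: "\<And>\<gamma>. \<gamma> \<in> Poly_Mapping.keys p \<Longrightarrow> \<gamma> \<noteq> \<alpha> \<Longrightarrow> power_prod_greater \<alpha> \<gamma>"
    and supp: "\<And>v. Poly_Mapping.lookup \<alpha> v \<noteq> 0 \<Longrightarrow> v = (i, j) \<or> fst v = j \<and> snd v < j"
  shows "Poly_Mapping.lookup (row_subst i j p) \<alpha> = Poly_Mapping.lookup p \<alpha>"
proof -
  have "row_index i j v = v \<and> row_sign i j v = 1" if "Poly_Mapping.lookup \<alpha> v \<noteq> 0" for v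
    using supp[OF that] ji by (auto simp: case_prod_beta)
  then have self: "rename (row_index i j) \<alpha> = \<alpha>" "weight (row_sign i j) \<alpha> = 1"
    by (simp_all add: rename_id weight_eq_1)
  have "Poly_Mapping.lookup (row_subst i j p) \<alpha> = (\<Sum>\<gamma>\<in>Poly_Mapping.keys p.
      if \<gamma> = \<alpha> then Poly_Mapping.lookup p \<gamma> else 0)"
    unfolding row_subst_def subst_scaled_def lookup_sum
  proof (rule sum.cong)
    fix \<gamma> assume \<gamma>: "\<gamma> \<in> Poly_Mapping.keys p"
    show "Poly_Mapping.lookup (Poly_Mapping.single (rename (row_index i j) \<gamma>)
        (weight (row_sign i j) \<gamma> * Poly_Mapping.lookup p \<gamma>)) \<alpha> =
        (if \<gamma> = \<alpha> then Poly_Mapping.lookup p \<gamma> else 0)"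
    proof (cases "\<gamma> = \<alpha>")
      case True
      then show ?thesis
        by (simp add: self)
    next
      case False
      then have "rename (row_index i j) \<gamma> \<noteq> \<alpha> \<or> weight (row_sign i j) \<gamma> = 0"
        using rename_row_not_smaller[OF ji, of \<gamma> \<alpha>] \<alpha>[OF \<gamma>] by blast
      then show ?thesis
        using False by (auto simp: lookup_single when_def)
    qed
  qed simp
  then show ?thesis
    by (simp add: sum.delta in_keys_iff)
qed

lemma leading_term_keys:
  assumes "is_leading_term f (\<alpha>, b)" and "\<gamma> \<in> Poly_Mapping.keys (Poly_Mapping.lookup f b)" "\<gamma> \<noteq> \<alpha>"
  shows "power_prod_greater \<alpha> \<gamma>"
  using assms
  by (auto simp: is_leading_term_def vec_terms_def term_greater_def basis_greater_def split: prod.splits)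

text \<open>If \<alpha> r_ijk were leading, the coefficient of x_jk \<alpha> in
  \<open>row_map i j f\<close> would be the leading coefficient of \<open>f\<close>, but this image
  is 0.\<close>

lemma row_monomial_not_leading:
  assumes f: "f \<in> im_Psi n" and idx: "k < j" "j < i"
    and supp: "\<And>v. Poly_Mapping.lookup \<alpha> v \<noteq> 0 \<Longrightarrow> v = (i, j) \<or> fst v = j \<and> snd v \<le> k"
  shows "\<not> is_leading_term f (\<alpha>, i, j, k)"
proof
  assume lead: "is_leading_term f (\<alpha>, i, j, k)"
  let ?\<mu> = "\<alpha> + Poly_Mapping.single (j, k) 1"
  have coeff: "Poly_Mapping.lookup (xv j l * row_subst i j (Poly_Mapping.lookup f (i, j, l))) ?\<mu> =
      (if l = k then Poly_Mapping.lookup (Poly_Mapping.lookup f (i, j, k)) \<alpha> else 0)"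
    if "l < j" for l
  proof -
    consider "l < k" | "l = k" | "k < l"
      by linarith
    then show ?thesis
    proof cases
      case 1
      \<comment> \<open>For l < k the basis element r_ijl is larger than r_ijk, so \<open>f\<close>
        has no component there.\<close>
      then have "term_greater (\<beta>, i, j, l) (\<alpha>, i, j, k)" for \<beta>
        by (intro term_greater_basis) (simp add: basis_greater_def)
      then have "Poly_Mapping.lookup f (i, j, l) = 0"
        using leading_term_lookup_eq_0[OF lead] by (intro poly_mapping_eqI) simp
      then show ?thesis
        using 1 by (simp add: row_subst_simps)
    next
      case 2
      have "Poly_Mapping.lookup (row_subst i j (Poly_Mapping.lookup f (i, j, k))) \<alpha> =
          Poly_Mapping.lookup (Poly_Mapping.lookup f (i, j, k)) \<alpha>"
      proof (rule lookup_row_subst_leading[OF idx(2)])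
        show "v = (i, j) \<or> fst v = j \<and> snd v < j" if "Poly_Mapping.lookup \<alpha> v \<noteq> 0" for v
          using supp[OF that] idx by auto
      qed (rule leading_term_keys[OF lead])
      then show ?thesis
        using 2 by (subst mult.commute) (simp add: lookup_mult_xv lookup_add)
    next
      case 3
      \<comment> \<open>For l > k the variable x_jl divides neither x_jk nor, by
        \<open>supp\<close>, \<alpha>.\<close>
      then have "Poly_Mapping.lookup ?\<mu> (j, l) = 0"
        using supp[of "(j, l)"] idx by (auto simp: lookup_add lookup_single when_def)
      then show ?thesis
        using 3 by (subst mult.commute) (simp add: lookup_mult_xv)
    qed
  qed
  have "0 = Poly_Mapping.lookup (row_map i j f) ?\<mu>"
    using row_map_im_Psi[OF f idx(2)] by simp
  also have "\<dots> = (\<Sum>l<j. if l = k then Poly_Mapping.lookup (Poly_Mapping.lookup f (i, j, k)) \<alpha> else 0)"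
    unfolding row_map_def lookup_sum using coeff by (intro sum.cong) auto
  also have "\<dots> = Poly_Mapping.lookup (Poly_Mapping.lookup f (i, j, k)) \<alpha>"
    using idx by simp
  finally show False
    using lead by (simp add: is_leading_term_def vec_terms_iff)
qed

section \<open>Torsion monomials\<close>

lemma power_prod_greater_add:
  "power_prod_greater \<alpha> \<beta> \<Longrightarrow> power_prod_greater (\<gamma> + \<alpha>) (\<gamma> + \<beta>)"
  by (auto simp: power_prod_greater_def total_deg_add lookup_add)

text \<open>The other four terms read by \<open>torsion_coeff\<close> are larger: one has x_ip in
  place of x_kp, three lie on larger basis elements. They are absent from \<open>f\<close>, so the
  functional returns the leading coefficient.\<close>

lemma torsion_monomial_not_leading:
  assumes f: "f \<in> im_Psi n" and idx: "p < k" "k < j" "j < i"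
  shows "\<not> is_leading_term f (Poly_Mapping.single (i, j) a + Poly_Mapping.single (k, p) 1, i, j, k)"
proof
  let ?m = "\<lambda>w. Poly_Mapping.single (i, j) a + Poly_Mapping.single w 1 :: power_prod"
  assume lead: "is_leading_term f (?m (k, p), i, j, k)"
  note zero = leading_term_lookup_eq_0[OF lead]
  have "term_greater (?m (i, p), i, j, k) (?m (k, p), i, j, k)"
    using idx unfolding term_greater_def
    by (simp add: power_prod_greater_add[OF power_prod_greater_var, unfolded One_nat_def]
        var_greater_def)
  moreover have "basis_greater (i, j, p) (i, j, k)" "basis_greater (i, k, p) (i, j, k)"
    "basis_greater (j, k, p) (i, j, k)"
    using idx by (simp_all add: basis_greater_def)
  ultimately have "torsion_coeff a i j k p f = Poly_Mapping.lookup (Poly_Mapping.lookup f (i, j, k)) (?m (k, p))"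
    unfolding torsion_coeff_def Let_def by (simp add: zero[OF term_greater_basis] zero del: One_nat_def)
  then show False
    using torsion_coeff_im_Psi[OF f idx] lead by (simp add: is_leading_term_def vec_terms_iff)
qed

section \<open>The Groebner basis\<close>

lemma generated_submodule_inc: "A \<subseteq> generated_submodule n A"
  unfolding generated_submodule_def by (rule hull_subset)

lemma generated_submodule_minimal:
  "A \<subseteq> N \<Longrightarrow> submodule N (S_ring n) (F_module n) \<Longrightarrow> generated_submodule n A \<subseteq> N"
  unfolding generated_submodule_def by (rule hull_minimal)

section \<open>Membership of the quadratic elements\<close>

lemma B_set_subset_im_Psi: "(i, j, k) \<in> basis_indices n \<Longrightarrow> B_set n i j k \<subseteq> im_Psi n"
  unfolding im_Psi_def by (rule order_trans[OF _ generated_submodule_inc]) auto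

lemma im_Psi_add: "f \<in> im_Psi n \<Longrightarrow> g \<in> im_Psi n \<Longrightarrow> f + g \<in> im_Psi n"
  using module.submoduleE(5)[OF module_F_module im_Psi_submodule] by simp

lemma im_Psi_scale: "p \<in> carrier (S_ring n) \<Longrightarrow> f \<in> im_Psi n \<Longrightarrow> p \<odot>\<^sub>F f \<in> im_Psi n"
  using module.submoduleE(4)[OF module_F_module im_Psi_submodule] by simp

text \<open>Modulo im Psi, x_kp r_ijk = x_ij r_ikp, and x_jq annihilates r_ikp.\<close>

lemma mixed_product_in_im_Psi:
  assumes idx: "1 \<le> p" "p < k" "k < j" "j < i" "i \<le> n" and q: "1 \<le> q" "q \<le> k"
  shows "(xv j q * xv k p) \<odot>\<^sub>F rb i j k \<in> im_Psi n"
proof -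
  let ?u = "- xv k p \<odot>\<^sub>F rb i j k + xv i j \<odot>\<^sub>F rb i k p"
  let ?v = "xv j q \<odot>\<^sub>F rb i k p"
  have ikp: "(i, k, p) \<in> basis_indices n"
    using idx by (simp add: basis_indices_def)
  have "?u \<in> B_set n i k p"
    using idx by (intro B_setI)
  then have u: "?u \<in> im_Psi n"
    using B_set_subset_im_Psi[OF ikp] by blast
  \<comment> \<open>Each case places x_jq r_ikp in a different family of monomial generators for the
    triple (i, k, p), with j strictly between i and k.\<close>
  consider "q = k" | "q = p" | "{j, q} \<inter> {i, k, p} = {}"
    using idx q by auto
  then have "?v \<in> B_set n i k p"
  proof cases
    case 3
    then show ?thesis
      using idx q by (intro B_setI(12)) linarith+
  qed (use idx in \<open>simp_all add: B_setI(8,9)\<close>)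
  then have v: "?v \<in> im_Psi n"
    using B_set_subset_im_Psi[OF ikp] by blast
  have "(- xv j q) \<odot>\<^sub>F ?u + xv i j \<odot>\<^sub>F ?v \<in> im_Psi n"
    using idx q by (intro im_Psi_add im_Psi_scale u v S_ring_closed(3) xv_closed) linarith+
  also have "(- xv j q) \<odot>\<^sub>F ?u + xv i j \<odot>\<^sub>F ?v = (xv j q * xv k p) \<odot>\<^sub>F rb i j k"
    by (rule poly_mapping_eqI) (simp add: lookup_add algebra_simps)
  finally show ?thesis .
qed

text \<open>Modulo im Psi, (x_jp + x_kp) r_ijk = x_jk r_ijp, and x_kl annihilates r_ijp. The
  remaining term x_jp x_kl r_ijk is a mixed product.\<close>

lemma torsion_product_in_im_Psi:
  assumes idx: "1 \<le> p" "p \<le> l" "l < k" "k < j" "j < i" "i \<le> n"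
  shows "(xv k l * xv k p) \<odot>\<^sub>F rb i j k \<in> im_Psi n"
proof -
  let ?u = "(- xv j p - xv k p) \<odot>\<^sub>F rb i j k + xv j k \<odot>\<^sub>F rb i j p"
  let ?v = "xv k l \<odot>\<^sub>F rb i j p"
  let ?w = "(xv j p * xv k l) \<odot>\<^sub>F rb i j k"
  have ijp: "(i, j, p) \<in> basis_indices n"
    using idx by (simp add: basis_indices_def)
  have "?u \<in> B_set n i j p"
    using idx by (intro B_setI) linarith+
  then have u: "?u \<in> im_Psi n"
    using B_set_subset_im_Psi[OF ijp] by blast
  consider "l = p" | "{k, l} \<inter> {i, j, p} = {}"
    using idx by auto
  then have "?v \<in> B_set n i j p"
  proof cases
    case 2
    then show ?thesis
      using idx by (intro B_setI(12)) linarith+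
  qed (use idx in \<open>simp add: B_setI(7)\<close>)
  then have v: "?v \<in> im_Psi n"
    using B_set_subset_im_Psi[OF ijp] by blast
  have w: "?w \<in> im_Psi n"
    using idx by (intro mixed_product_in_im_Psi) linarith+
  have "(- xv k l) \<odot>\<^sub>F ?u + (xv j k \<odot>\<^sub>F ?v + (- 1) \<odot>\<^sub>F ?w) \<in> im_Psi n"
    using idx by (intro im_Psi_add im_Psi_scale u v w S_ring_closed(2,3) xv_closed) linarith+
  also have "(- xv k l) \<odot>\<^sub>F ?u + (xv j k \<odot>\<^sub>F ?v + (- 1) \<odot>\<^sub>F ?w) = (xv k l * xv k p) \<odot>\<^sub>F rb i j k"
    by (rule poly_mapping_eqI) (simp add: lookup_add algebra_simps)
  finally show ?thesis .
qed

lemma G_set_subset_im_Psi: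
  assumes "(i, j, k) \<in> basis_indices n"
  shows "G_set n i j k \<subseteq> im_Psi n"
proof -
  have "k < j" "j < i" "i \<le> n"
    using assms by (auto simp: basis_indices_def)
  then have "D_set i j k \<subseteq> im_Psi n"
    by (auto simp: D_set_def intro!: torsion_product_in_im_Psi mixed_product_in_im_Psi)
  then show ?thesis
    using B_set_subset_im_Psi[OF assms] by (simp add: G_set_def)
qed

section \<open>Finiteness\<close>

lemma finite_basis_indices: "finite (basis_indices n)"
  by (rule finite_subset[of _ "{..n} \<times> {..n} \<times> {..n}"]) (auto simp: basis_indices_def)

lemma finite_image_bounded:
  assumes "\<And>x. P x \<Longrightarrow> x \<le> (m :: nat)"
  shows "finite {f x | x. P x}"
  by (rule finite_image_set) (use assms in \<open>auto intro: finite_subset[of _ "{..m}"]\<close>)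

lemma finite_image_bounded2:
  assumes "\<And>x y. P x y \<Longrightarrow> x \<le> (m :: nat) \<and> y \<le> m"
  shows "finite {f x y | x y. P x y}"
proof (rule finite_subset)
  show "{f x y | x y. P x y} \<subseteq> (\<lambda>(x, y). f x y) ` ({..m} \<times> {..m})"
    using assms by force
qed simp

lemma finite_G_set:
  assumes "(i, j, k) \<in> basis_indices n"
  shows "finite (G_set n i j k)"
proof -
  have idx: "k < j" "j < i" "i \<le> n"
    using assms by (auto simp: basis_indices_def)
  \<comment> \<open>Some l with p \<le> l < k exists exactly when p < k, which leaves a family in
    two bounded indices.\<close>
  have "{(xv j q * xv k p) \<odot>\<^sub>F rb i j k | l p q. 1 \<le> p \<and> p \<le> l \<and> l < k \<and> 1 \<le> q \<and> q \<le> k} =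
      {(xv j q * xv k p) \<odot>\<^sub>F rb i j k | p q. 1 \<le> p \<and> p < k \<and> 1 \<le> q \<and> q \<le> k}"
    by (auto intro: order_le_less_trans)
  then have "finite (D_set i j k)"
    unfolding D_set_def
    by (simp only: finite_Un) (intro conjI finite_image_bounded2[where m = k]; auto)
  moreover have "finite (B_set n i j k)"
    unfolding B_set_def finite_Un using idx
    by (intro conjI finite_image_bounded[where m = n] finite_image_bounded2[where m = n]
        finite.intros; auto)
  ultimately show ?thesis
    by (simp add: G_set_def)
qed

section \<open>Divisibility of leading terms\<close>

lemma power_prod_split:
  fixes \<alpha> \<beta> :: power_prod
  assumes "\<And>v. Poly_Mapping.lookup \<beta> v \<le> Poly_Mapping.lookup \<alpha> v"
  shows "\<exists>\<delta>. \<alpha> = \<delta> + \<beta>"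
  by (rule exI[of _ "\<alpha> - \<beta>"], rule poly_mapping_eqI) (simp add: lookup_add lookup_minus assms)

lemma initial_term_xv_mult:
  "initial_term ((xv s t * xv s' t') \<odot>\<^sub>F rb i j k) = Poly_Mapping.single (i, j, k)
     (Poly_Mapping.single (Poly_Mapping.single (s, t) 1 + Poly_Mapping.single (s', t') 1) 1)"
proof -
  have "(xv s t * xv s' t') \<odot>\<^sub>F rb i j k = Poly_Mapping.single (i, j, k)
      (Poly_Mapping.single (Poly_Mapping.single (s, t) 1 + Poly_Mapping.single (s', t') 1) 1) + 0"
    by (rule poly_mapping_eqI) (auto simp: lookup_rb xv_def mult_single lookup_single when_def)
  also have "initial_term \<dots> = Poly_Mapping.single (i, j, k)
      (Poly_Mapping.single (Poly_Mapping.single (s, t) 1 + Poly_Mapping.single (s', t') 1) 1)"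
    by (rule initial_term_add) (auto simp: vec_terms_def)
  finally show ?thesis .
qed

lemma leading_term_carrier:
  assumes "f \<in> carrier (F_module n)" "is_leading_term f (\<alpha>, b)"
  shows "b \<in> basis_indices n" "Poly_Mapping.keys \<alpha> \<subseteq> var_indices n"
proof -
  have "Poly_Mapping.lookup f b \<noteq> 0" "\<alpha> \<in> Poly_Mapping.keys (Poly_Mapping.lookup f b)"
    using assms(2) by (auto simp: is_leading_term_def vec_terms_def)
  moreover have "Poly_Mapping.keys f \<subseteq> basis_indices n"
    "Poly_Mapping.lookup f b \<in> carrier (S_ring n)"
    using assms(1) by (simp_all add: F_module_def del: split_paired_All)
  ultimately show "b \<in> basis_indices n" "Poly_Mapping.keys \<alpha> \<subseteq> var_indices n"
    by (auto simp: S_ring_def in_keys_iff simp del: split_paired_All)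
qed

text \<open>A monomial that no initial term of G_ijk divides is standard, and the two families of
  standard monomials have been shown not to lead an element of im Psi.\<close>

lemma leading_term_divisible:
  assumes f: "f \<in> im_Psi n" and lead: "is_leading_term f (\<alpha>, i, j, k)"
  shows "\<exists>g\<in>G_set n i j k. \<exists>\<beta> \<delta>. \<alpha> = \<delta> + \<beta> \<and>
    initial_term g = Poly_Mapping.single (i, j, k) (Poly_Mapping.single \<beta> 1)"
proof (cases "\<exists>s t. Poly_Mapping.lookup \<alpha> (s, t) \<noteq> 0 \<and> (s, t) \<noteq> (i, j) \<and> (s = j \<longrightarrow> k < t) \<and> s \<noteq> k")
  case True
  note carrier = leading_term_carrier[OF subsetD[OF im_Psi_closed f] lead]
  from True obtain s t where st: "Poly_Mapping.lookup \<alpha> (s, t) \<noteq> 0" and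
    nonfree: "(s, t) \<noteq> (i, j)" "s = j \<longrightarrow> k < t" "s \<noteq> k"
    by blast
  have "(s, t) \<in> var_indices n"
    using carrier(2) st by (auto simp: in_keys_iff)
  then obtain g where "g \<in> B_set n i j k" "initial_term g = xv s t \<odot>\<^sub>F rb i j k"
    using B_set_initial_term[OF carrier(1) _ nonfree] by blast
  moreover have "Poly_Mapping.lookup (Poly_Mapping.single (s, t) 1) v \<le> Poly_Mapping.lookup \<alpha> v" for v
    using st by (auto simp: lookup_single when_def)
  then have "\<exists>\<delta>. \<alpha> = \<delta> + Poly_Mapping.single (s, t) 1"
    by (rule power_prod_split)
  ultimately show ?thesis
    unfolding G_set_def xv_rb by blast
next
  case False
  have free: "(s, t) = (i, j) \<or> s = j \<and> t \<le> k \<or> s = k" if "Poly_Mapping.lookup \<alpha> (s, t) \<noteq> 0" for s t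
    using False that by (meson not_le)
  note carrier = leading_term_carrier[OF subsetD[OF im_Psi_closed f] lead]
  have idx: "1 \<le> k" "k < j" "j < i" "i \<le> n"
    using carrier(1) by (auto simp: basis_indices_def)
  have var: "1 \<le> t \<and> t < s" if "Poly_Mapping.lookup \<alpha> (s, t) \<noteq> 0" for s t
    using subsetD[OF carrier(2), of "(s, t)"] that by (simp add: in_keys_iff var_indices_def)
  \<comment> \<open>Otherwise \<alpha> is a monomial in x_ij and the x_jq with q \<le> k, which the
    row homomorphism rules out.\<close>
  have "\<exists>p. Poly_Mapping.lookup \<alpha> (k, p) \<noteq> 0"
  proof (rule ccontr)
    assume "\<nexists>p. Poly_Mapping.lookup \<alpha> (k, p) \<noteq> 0"
    then have "v = (i, j) \<or> fst v = j \<and> snd v \<le> k" if "Poly_Mapping.lookup \<alpha> v \<noteq> 0" for v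
      using free[of "fst v" "snd v"] that by (cases v) auto
    then show False
      using row_monomial_not_leading[OF f idx(2,3), of \<alpha>] lead by blast
  qed
  then obtain p where p: "Poly_Mapping.lookup \<alpha> (k, p) \<noteq> 0"
    by blast
  then have p_idx: "1 \<le> p" "p < k"
    using var by blast+
  have D: ?thesis if mem: "(xv s t * xv s' t') \<odot>\<^sub>F rb i j k \<in> D_set i j k"
    and le: "\<And>v. Poly_Mapping.lookup (Poly_Mapping.single (s, t) 1 + Poly_Mapping.single (s', t') 1) v
      \<le> Poly_Mapping.lookup \<alpha> v" for s t s' t'
  proof -
    obtain \<delta> where
      "\<alpha> = \<delta> + (Poly_Mapping.single (s, t) 1 + Poly_Mapping.single (s', t') 1)"
      using power_prod_split[OF le] by blast
    then show ?thesis
      using mem initial_term_xv_mult unfolding G_set_def by blast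
  qed
  have DI1: "(xv k l * xv k l') \<odot>\<^sub>F rb i j k \<in> D_set i j k" if "1 \<le> l'" "l' \<le> l" "l < k" for l l'
    using that unfolding D_set_def by blast
  have DI2: "(xv j q * xv k p) \<odot>\<^sub>F rb i j k \<in> D_set i j k" if "1 \<le> q" "q \<le> k" for q
    using that p_idx unfolding D_set_def by blast
  \<comment> \<open>Next to one factor x_kp, either \<alpha> has another factor x_kl or x_jq, and an
    element of D_ijk applies, or \<alpha> is x_ij^a x_kp.\<close>
  consider "Poly_Mapping.lookup \<alpha> (k, p) \<noteq> 1"
    | l where "l \<noteq> p" "Poly_Mapping.lookup \<alpha> (k, l) \<noteq> 0"
    | q where "Poly_Mapping.lookup \<alpha> (j, q) \<noteq> 0"
    | "Poly_Mapping.lookup \<alpha> (k, p) = 1" "\<And>l. l \<noteq> p \<Longrightarrow> Poly_Mapping.lookup \<alpha> (k, l) = 0"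
      "\<And>q. Poly_Mapping.lookup \<alpha> (j, q) = 0"
    by blast
  then show ?thesis
  proof cases
    case 1
    with p have "2 \<le> Poly_Mapping.lookup \<alpha> (k, p)"
      by linarith
    then show ?thesis
      using p_idx by (intro D[OF DI1[of p p]]) (auto simp: lookup_add lookup_single when_def)
  next
    case (2 l)
    have l_idx: "1 \<le> l" "l < k"
      using var[OF 2(2)] by simp_all
    have le: "Poly_Mapping.lookup (Poly_Mapping.single (k, l) 1 + Poly_Mapping.single (k, p) 1) v
        \<le> Poly_Mapping.lookup \<alpha> v" for v
      using 2 p by (auto simp: lookup_add lookup_single when_def)
    show ?thesis
    proof (cases "p \<le> l")
      case True
      then show ?thesis
        using p_idx l_idx le by (intro D[OF DI1[of p l]]) auto
    next
      case False
      then show ?thesis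
        using p_idx l_idx le by (intro D[OF DI1[of l p]]) (auto simp: add.commute)
    qed
  next
    case (3 q)
    have "1 \<le> q" "q \<le> k"
      using var[OF 3] free[OF 3] idx by auto
    then show ?thesis
      using 3 p idx by (intro D[OF DI2[of q]]) (auto simp: lookup_add lookup_single when_def)
  next
    case 4
    have "\<alpha> = Poly_Mapping.single (i, j) (Poly_Mapping.lookup \<alpha> (i, j)) + Poly_Mapping.single (k, p) 1"
    proof (rule poly_mapping_eqI)
      fix v
      show "Poly_Mapping.lookup \<alpha> v = Poly_Mapping.lookup (Poly_Mapping.single (i, j)
          (Poly_Mapping.lookup \<alpha> (i, j)) + Poly_Mapping.single (k, p) 1) v"
      proof (cases "v = (i, j) \<or> v = (k, p)")
        case True
        then show ?thesis
          using 4(1) idx by (auto simp: lookup_add lookup_single when_def)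
      next
        case False
        moreover have "Poly_Mapping.lookup \<alpha> v = 0"
          using False free[of "fst v" "snd v"] 4(2)[of "snd v"] 4(3)[of "snd v"]
          by (cases v) fastforce
        ultimately show ?thesis
          by (auto simp: lookup_add lookup_single when_def)
      qed
    qed
    then show ?thesis
      using torsion_monomial_not_leading[OF f p_idx(2) idx(2,3)] lead by metis
  qed
qed

lemma initial_term_closed:
  assumes "f \<in> carrier (F_module n)"
  shows "initial_term f \<in> carrier (F_module n)"
proof (cases "f = 0")
  case True
  then show ?thesis
    by (simp add: initial_term_def F_module_closed)
next
  case False
  then obtain \<alpha> b where lead: "is_leading_term f (\<alpha>, b)"
    using is_leading_term_exists by (metis surj_pair)
  show ?thesis
    using leading_term_carrier[OF assms lead]
    by (auto simp: initial_term_eq[OF lead] F_module_def S_ring_def lookup_single when_def)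
qed

theorem theorem4p1:
  fixes n :: nat
  assumes "n \<ge> 3"
  shows "groebner_basis n (im_Psi n) (\<Union>(i, j, k)\<in>basis_indices n. G_set n i j k)"
proof -
  let ?G = "\<Union>(i, j, k)\<in>basis_indices n. G_set n i j k"
  let ?in_G = "generated_submodule n (initial_term ` ?G)"
  have G: "?G \<subseteq> im_Psi n"
    using G_set_subset_im_Psi by blast
  have "im_Psi n \<subseteq> generated_submodule n ?G"
    unfolding im_Psi_def generated_submodule_def G_set_def by (rule hull_mono) blast
  then have gen: "generated_submodule n ?G = im_Psi n"
    using generated_submodule_minimal[OF G im_Psi_submodule] by blast
  have closed: "initial_term ` im_Psi n \<subseteq> carrier (F_module n)"
    using im_Psi_closed initial_term_closed by blast
  have in_G: "submodule ?in_G (S_ring n) (F_module n)"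
    using closed G by (intro submodule_generated_submodule) blast
  \<comment> \<open>The initial term of \<open>f\<close> is a single term times the initial term of
    one basis member, so no sum of multiples has to be found.\<close>
  have "initial_term f \<in> ?in_G" if f: "f \<in> im_Psi n" for f
  proof (cases "f = 0")
    case True
    then show ?thesis
      using subgroup.one_closed[OF submodule.axioms(1)[OF in_G]] by (simp add: initial_term_def)
  next
    case False
    then obtain \<alpha> i j k where lead: "is_leading_term f (\<alpha>, i, j, k)"
      using is_leading_term_exists by (metis surj_pair)
    note carrier = leading_term_carrier[OF subsetD[OF im_Psi_closed f] lead]
    obtain g \<beta> \<delta> where g: "g \<in> G_set n i j k" and \<alpha>: "\<alpha> = \<delta> + \<beta>"
      and in_g: "initial_term g = Poly_Mapping.single (i, j, k) (Poly_Mapping.single \<beta> 1)"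
      using leading_term_divisible[OF f lead] by blast
    \<comment> \<open>The initial term of \<open>g\<close> has coefficient 1, so the multiplier
      carries the leading coefficient of \<open>f\<close>.\<close>
    let ?p = "Poly_Mapping.single \<delta> (Poly_Mapping.lookup (Poly_Mapping.lookup f (i, j, k)) \<alpha>)"
    have "Poly_Mapping.keys \<delta> \<subseteq> Poly_Mapping.keys \<alpha>"
      by (auto simp: \<alpha> in_keys_iff lookup_add)
    then have "?p \<in> carrier (S_ring n)"
      using carrier(2) by (auto simp: S_ring_def)
    moreover have "g \<in> ?G"
      by (rule UN_I[OF carrier(1)]) (simp add: g)
    then have "initial_term g \<in> ?in_G"
      by (intro subsetD[OF generated_submodule_inc] imageI)
    ultimately have "?p \<odot>\<^sub>F initial_term g \<in> ?in_G"
      using module.submoduleE(4)[OF module_F_module in_G] by simp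
    also have "?p \<odot>\<^sub>F initial_term g = initial_term f"
      unfolding initial_term_eq[OF lead] in_g
      by (rule poly_mapping_eqI) (simp add: lookup_single mult_single when_def \<alpha>)
    finally show ?thesis .
  qed
  then have "initial_submodule n (im_Psi n) \<subseteq> ?in_G"
    unfolding initial_submodule_def using in_G by (intro generated_submodule_minimal) blast+
  moreover have "?in_G \<subseteq> initial_submodule n (im_Psi n)"
    unfolding initial_submodule_def generated_submodule_def using G by (intro hull_mono) blast
  moreover have "finite ?G"
    using finite_basis_indices finite_G_set by (intro finite_UN_I) auto
  ultimately show ?thesis
    using G gen im_Psi_submodule unfolding groebner_basis_def by blast
qed

end
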